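(* Suppose $f+R$ satisfies the Kurdyka–Łojasiewicz condition with constant $\mu>0$: for all $x\in\mathbb{R}^d$ and $u\in\partial R(x)$, $\|\nabla f(x)+u\|^2\ge2\mu(f(x)+R(x)-f^\star-R^\star)$, where $f^\star=f(x^\star)$, $R^\star=R(x^\star)$ for a minimizer $x^\star$ of $f+R$. In DIANA (i.e., EF-BV with $\nu=1$) with compressors in $\mathbb{C}(\eta,\omega)$, suppose $\lambda\in(0,1]$ is such that $r<1$ and $$0<\gamma\le\frac{1}{2L+\tilde L\sqrt{\frac{r_{\mathrm{av}}}{r}}\frac1{s^\star}}.$$ For $t\ge0$ let $\Psi^t=f(x^t)+R(x^t)-f^\star-R^\star+\frac{\gamma}{2\theta^\star}\frac1n\sum_{i=1}^n\|\nabla f_i(x^t)-h_i^t\|^2$. Then for every $t\ge0$, $\mathbb{E}[\Psi^t]\le\big(\max(\frac{1}{1+\frac12\gamma\mu},\frac{r+1}{2})\big)^t\Psi^0$.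
   Context: $f=\frac1n\sum_if_i$, each $f_i:\mathbb{R}^d\to\mathbb{R}$ convex and $L_i$-smooth; $\tilde L=\sqrt{\frac1n\sum_iL_i^2}$; $f$ is $L$-smooth with $L\le\tilde L$; $R:\mathbb{R}^d\to\mathbb{R}\cup\{+\infty\}$ proper closed convex, $\mathrm{prox}_{\gamma R}(x)=\arg\min_y(\gamma R(y)+\frac12\|x-y\|^2)$; a minimizer of $f+R$ exists. For $\eta\in[0,1)$, $\omega\ge0$, $\mathbb{C}(\eta,\omega)$ is the class of randomized operators $\mathcal{C}:\mathbb{R}^d\to\mathbb{R}^d$ with $\|\mathbb{E}[\mathcal{C}(x)]-x\|\le\eta\|x\|$ and $\mathbb{E}\|\mathcal{C}(x)-\mathbb{E}[\mathcal{C}(x)]\|^2\le\omega\|x\|^2$ for all $x$. Compressors $\mathcal{C}_i^t$ all lie in $\mathbb{C}(\eta,\omega)$, those at iteration $t$ are independent of previous randomness, and $\omega_{\mathrm{av}}\in[0,\omega]$ satisfies $\mathbb{E}\|\frac1n\sum_i(\mathcal{C}_i^t(x_i)-\mathbb{E}[\mathcal{C}_i^t(x_i)])\|^2\le\frac{\omega_{\mathrm{av}}}{n}\sum_i\|x_i\|^2$ for all $t$ and $x_1,\dots,x_n$. DIANA: given $x^0,h_1^0,\dots,h_n^0$, $\gamma>0$, $\lambda\in(0,1]$, $h^0=\frac1n\sum_ih_i^0$; for $t\ge0$: $d_i^t=\mathcal{C}_i^t(\nabla f_i(x^t)-h_i^t)$, $h_i^{t+1}=h_i^t+\lambda d_i^t$,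 $d^t=\frac1n\sum_id_i^t$, $h^{t+1}=h^t+\lambda d^t$, $g^{t+1}=h^t+d^t$, $x^{t+1}=\mathrm{prox}_{\gamma R}(x^t-\gamma g^{t+1})$. Constants: $r=(1-\lambda+\lambda\eta)^2+\lambda^2\omega$, $r_{\mathrm{av}}=\eta^2+\omega_{\mathrm{av}}$, $s^\star=\sqrt{\frac{1+r}{2r}}-1$, $\theta^\star=s^\star(1+s^\star)\frac{r}{r_{\mathrm{av}}}$ (with $r>0$, $r_{\mathrm{av}}>0$). *)

theory Defs
  imports "HOL-Probability.Probability"
begin

text \<open>A proper closed convex function R : R^d -> R \<union> {+\<infinity>} is represented by its
  effective domain D (where R is finite) and its values R on D; outside D, R = +\<infinity>.\<close>

definition epigraph :: "('a \<Rightarrow> real) \<Rightarrow> 'a set \<Rightarrow> ('a \<times> real) set" where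
  "epigraph R D = {(x, s). x \<in> D \<and> R x \<le> s}"

definition proper_closed_convex :: "('a::euclidean_space \<Rightarrow> real) \<Rightarrow> 'a set \<Rightarrow> bool" where
  "proper_closed_convex R D \<longleftrightarrow> D \<noteq> {} \<and> closed (epigraph R D) \<and> convex (epigraph R D)"

definition subdiff :: "('a::real_inner \<Rightarrow> real) \<Rightarrow> 'a set \<Rightarrow> 'a \<Rightarrow> 'a set" where
  "subdiff R D x = {u. x \<in> D \<and> (\<forall>y\<in>D. R y \<ge> R x + inner u (y - x))}"

definition prox :: "real \<Rightarrow> ('a::real_normed_vector \<Rightarrow> real) \<Rightarrow> 'a set \<Rightarrow> 'a \<Rightarrow> 'a" where
  "prox \<gamma> R D x = (THE y. y \<in> D \<and>
     (\<forall>z\<in>D. \<gamma> * R y + (norm (x - y))\<^sup>2 / 2 \<le> \<gamma> * R z + (norm (x - z))\<^sup>2 / 2))"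

text \<open>DIANA iterates. State at time t for sample point w: (x^t, (h_i^t)_i).
  The compressor C_i^t is realised as Cmp t i (\<xi> t w), where \<xi> t is the randomness of iteration t.\<close>
fun diana :: "nat \<Rightarrow> (nat \<Rightarrow> 'a::real_normed_vector \<Rightarrow> 'a) \<Rightarrow> (nat \<Rightarrow> nat \<Rightarrow> 'b \<Rightarrow> 'a \<Rightarrow> 'a)
    \<Rightarrow> (nat \<Rightarrow> 'o \<Rightarrow> 'b) \<Rightarrow> ('a \<Rightarrow> real) \<Rightarrow> 'a set \<Rightarrow> real \<Rightarrow> real \<Rightarrow> 'a \<Rightarrow> (nat \<Rightarrow> 'a)
    \<Rightarrow> nat \<Rightarrow> 'o \<Rightarrow> 'a \<times> (nat \<Rightarrow> 'a)" where
  "diana n gf Cmp \<xi> R D \<gamma> lam x0 h0 0 w = (x0, h0)"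
| "diana n gf Cmp \<xi> R D \<gamma> lam x0 h0 (Suc t) w =
    (let (x, h) = diana n gf Cmp \<xi> R D \<gamma> lam x0 h0 t w;
         d = (\<lambda>i. Cmp t i (\<xi> t w) (gf i x - h i));
         dbar = (1 / real n) *\<^sub>R (\<Sum>i<n. d i);
         hbar = (1 / real n) *\<^sub>R (\<Sum>i<n. h i);
         g = hbar + dbar
     in (prox \<gamma> R D (x - \<gamma> *\<^sub>R g), (\<lambda>i. h i + lam *\<^sub>R d i)))"

definition diana_r :: "real \<Rightarrow> real \<Rightarrow> real \<Rightarrow> real" where
  "diana_r \<eta> \<omega> lam = (1 - lam + lam * \<eta>)\<^sup>2 + lam\<^sup>2 * \<omega>"

definition s_star :: "real \<Rightarrow> real" where
  "s_star r = sqrt ((1 + r) / (2 * r)) - 1"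

definition theta_star :: "real \<Rightarrow> real \<Rightarrow> real" where
  "theta_star r rav = s_star r * (1 + s_star r) * r / rav"

end

theory Submission
  imports Defs
begin

text \<open>
  One step of the method is an inexact proximal gradient step, and by descent and convexity of
  \<open>F\<close> and \<open>R\<close> it is compared with \<open>p = prox_{(\<gamma>/2) (F + R)}(x)\<close>. The KL inequality and
  convexity at \<open>p\<close> show that the gap at \<open>p\<close> plus \<open>|p - x|^2 / (2 \<gamma>)\<close> is at most \<open>1 / K\<close> times
  the gap at \<open>x\<close>, whenever \<open>1 \<le> K \<le> min 2 (1 + \<gamma> \<mu> / 2)\<close>; here \<open>K = min (1 + \<gamma> \<mu> / 2) (2 / (1 + r))\<close>,
  so that \<open>1 / K\<close> is the claimed rate. The gradient error has conditional second moment at most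
  \<open>rav\<close> times the mean shift error, and the shift errors contract by \<open>(1 + s) r\<close> up to a multiple of
  \<open>|x' - x|^2\<close>, which the step size bound absorbs. With the weight \<open>\<gamma> / (2 \<theta>)\<close> the two
  contributions add up to the factor \<open>(1 + s)^2 r = (1 + r) / 2\<close>.
\<close>

section \<open>First-order optimality and existence of minimizers\<close>

lemma convex_epigraphD:
  assumes "convex (epigraph R D)" "x \<in> D" "y \<in> D" "0 \<le> t" "t \<le> 1"
  shows "x + t *\<^sub>R (y - x) \<in> D" "R (x + t *\<^sub>R (y - x)) \<le> R x + t * (R y - R x)"
proof -
  have "(1 - t) *\<^sub>R (x, R x) + t *\<^sub>R (y, R y) \<in> epigraph R D"
    using assms by (intro convexD) (auto simp: epigraph_def)
  moreover have "(1 - t) *\<^sub>R x + t *\<^sub>R y = x + t *\<^sub>R (y - x)"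
    by (simp add: algebra_simps)
  ultimately show "x + t *\<^sub>R (y - x) \<in> D" "R (x + t *\<^sub>R (y - x)) \<le> R x + t * (R y - R x)"
    by (auto simp: epigraph_def algebra_simps)
qed

lemma GDERIV_along_line:
  assumes "GDERIV H (p + t *\<^sub>R d) :> g"
  shows "((\<lambda>t. H (p + t *\<^sub>R d)) has_real_derivative inner g d) (at t)"
proof -
  have "((\<lambda>t. H (p + t *\<^sub>R d)) has_derivative (\<lambda>s. inner (s *\<^sub>R d) g)) (at t)"
    using assms unfolding gderiv_def
    by (intro has_derivative_compose[of "\<lambda>t. p + t *\<^sub>R d" "\<lambda>s. s *\<^sub>R d" t UNIV H]) (auto intro!: derivative_eq_intros)
  moreover have "(\<lambda>s. inner (s *\<^sub>R d) g) = (*) (inner g d)"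
    by (auto simp: inner_commute)
  ultimately show ?thesis
    by (simp add: has_field_derivative_def)
qed

text \<open>By convexity of \<open>R\<close>, the function \<open>\<phi>\<close> plus the constant
  \<open>R p\<close> dominates the objective on the segment from \<open>p\<close> to
  \<open>y\<close>. If the subgradient inequality failed at \<open>y\<close>, \<open>\<phi>\<close>
  would decrease at 0 and push the objective below its minimum. Convexity is asked of
  \<open>R\<close> alone, so \<open>H\<close> may even be concave.\<close>

lemma minimizer_imp_subgradient:
  assumes conv: "convex (epigraph R D)" and p: "p \<in> D"
    and min: "\<And>y. y \<in> D \<Longrightarrow> H p + R p \<le> H y + R y"
    and grad: "GDERIV H p :> g"
  shows "- g \<in> subdiff R D p"
proof -
  have "R y \<ge> R p + inner (- g) (y - p)" if y: "y \<in> D" for y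
  proof (rule ccontr)
    assume neg: "\<not> ?thesis"
    define \<phi> where "\<phi> t = H (p + t *\<^sub>R (y - p)) + t * (R y - R p)" for t
    have "((\<lambda>t. H (p + t *\<^sub>R (y - p))) has_real_derivative inner g (y - p)) (at 0)"
      using grad by (intro GDERIV_along_line) simp
    then have "(\<phi> has_real_derivative inner g (y - p) + (R y - R p)) (at 0)"
      unfolding \<phi>_def by (auto intro!: derivative_eq_intros)
    moreover have "inner g (y - p) + (R y - R p) < 0"
      using neg by (simp add: inner_minus_left)
    ultimately obtain d where d: "d > 0" "\<And>h. 0 < h \<Longrightarrow> h < d \<Longrightarrow> \<phi> (0 + h) < \<phi> 0"
      by (metis has_real_derivative_neg_dec_right UNIV_I)
    define h where "h = min 1 (d / 2)"
    have h: "0 < h" "h < d" "h \<le> 1" using d(1) by (auto simp: h_def)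
    have "H p + R p \<le> H (p + h *\<^sub>R (y - p)) + R (p + h *\<^sub>R (y - p))"
      using h by (intro min convex_epigraphD[OF conv p y]) auto
    also have "\<dots> \<le> \<phi> h + R p"
      using convex_epigraphD(2)[OF conv p y, of h] h by (simp add: \<phi>_def)
    finally show False
      using d(2)[OF h(1,2)] by (simp add: \<phi>_def)
  qed
  with p show ?thesis by (simp add: subdiff_def)
qed

text \<open>A closed epigraph only makes \<open>R\<close> lower semicontinuous, so the continuous
  function \<open>H y + s\<close> is minimized over points \<open>(y, s)\<close> of the epigraph
  instead. Cut at the level of \<open>y0\<close>, the epigraph becomes compact, and a minimizing
  \<open>(p, s)\<close> has \<open>R p \<le> s\<close>, so \<open>p\<close> minimizes
  \<open>H + R\<close>.\<close>

lemma closed_epigraph_attains_min: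
  fixes R :: "'a::euclidean_space \<Rightarrow> real"
  assumes cl: "closed (epigraph R D)" and y0: "y0 \<in> D"
    and H: "continuous_on UNIV H"
    and lower: "\<And>y. y \<in> D \<Longrightarrow> l \<le> H y + R y"
    and bdd: "bounded {y \<in> D. H y + R y \<le> H y0 + R y0}"
  obtains p where "p \<in> D" "\<And>y. y \<in> D \<Longrightarrow> H p + R p \<le> H y + R y"
proof -
  define c where "c = H y0 + R y0"
  define T where "T = {y \<in> D. H y + R y \<le> c}"
  define S where "S = epigraph R D \<inter> {z. H (fst z) + snd z \<le> c}"
  have cont: "continuous_on A (\<lambda>z::'a \<times> real. H (fst z) + snd z)" for A
    by (intro continuous_intros continuous_on_compose2[OF H]) auto
  have "closed S"
    unfolding S_def by (intro closed_Int cl closed_Collect_le cont continuous_intros)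
  have "bounded (closure T)" using bdd by (simp add: T_def c_def bounded_closure)
  then have "compact (closure T)" by (simp add: compact_eq_bounded_closed)
  then have "compact (H ` closure T)"
    by (intro compact_continuous_image continuous_on_subset[OF H]) auto
  then obtain B where B: "\<And>y. y \<in> T \<Longrightarrow> \<bar>H y\<bar> \<le> B"
    using closure_subset by (force dest!: compact_imp_bounded simp: bounded_iff)
  \<comment> \<open>Since \<open>H\<close> has values in \<open>[-B, B]\<close> on \<open>T\<close>,
    the bounds \<open>l\<close> and \<open>c\<close> confine the height:
    \<open>l - B \<le> R y \<le> s \<le> c + B\<close>.\<close>
  have "S \<subseteq> closure T \<times> {l - B..c + B}"
  proof
    fix z assume z: "z \<in> S"
    obtain y s where zs: "z = (y, s)" by fastforce
    have y: "y \<in> D" "R y \<le> s" "H y + s \<le> c" using z zs by (auto simp: S_def epigraph_def)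
    then have "y \<in> T" by (auto simp: T_def)
    then have "\<bar>H y\<bar> \<le> B" using B by auto
    moreover have "l \<le> H y + R y" using y lower by auto
    ultimately show "z \<in> closure T \<times> {l - B..c + B}"
      using y zs closure_subset \<open>y \<in> T\<close> by auto
  qed
  moreover have "compact (closure T \<times> {l - B..c + B})"
    by (intro compact_Times \<open>compact (closure T)\<close>) auto
  ultimately have "compact S"
    using \<open>closed S\<close> by (metis compact_Int_closed inf.absorb2)
  moreover have "(y0, R y0) \<in> S" using y0 by (auto simp: S_def epigraph_def c_def)
  ultimately obtain z where z: "z \<in> S" "\<And>z'. z' \<in> S \<Longrightarrow> H (fst z) + snd z \<le> H (fst z') + snd z'"
    using continuous_attains_inf[of S "\<lambda>z. H (fst z) + snd z"] cont by blast
  have zD: "fst z \<in> D" "R (fst z) \<le> snd z" "H (fst z) + snd z \<le> c"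
    using z(1) by (auto simp: S_def epigraph_def)
  have "H (fst z) + R (fst z) \<le> H y + R y" if y: "y \<in> D" for y
  proof (cases "H y + R y \<le> c")
    case True
    then show ?thesis using z(2)[of "(y, R y)"] y zD by (auto simp: S_def epigraph_def)
  qed (use zD in auto)
  with zD show ?thesis using that by blast
qed

section \<open>The proximal operator: well-definedness and nonexpansiveness\<close>

lemma GDERIV_sq_dist:
  fixes x y :: "'a::real_inner"
  shows "GDERIV (\<lambda>y. c * (norm (x - y))\<^sup>2) y :> (2 * c) *\<^sub>R (y - x)"
  unfolding gderiv_def power2_norm_eq_inner
  by (auto intro!: derivative_eq_intros ext simp: algebra_simps inner_commute)

lemma subdiff_monotone:
  assumes "u \<in> subdiff R D x" "v \<in> subdiff R D y"
  shows "0 \<le> inner (u - v) (x - y)"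
proof -
  have "R y \<ge> R x + inner u (y - x)" "R x \<ge> R y + inner v (x - y)"
    using assms by (auto simp: subdiff_def)
  then show ?thesis by (simp add: algebra_simps)
qed

text \<open>Expand the square of \<open>y + 2 \<gamma> v\<close>. The denominator
  \<open>4 \<gamma>\<close> spends only half of the term \<open>(norm y)^2 / (2 \<gamma>)\<close> of
  a prox objective; the other half is left for coercivity.\<close>

lemma norm_le_quadratic_bound:
  fixes v y :: "'a::real_inner"
  assumes "\<gamma> > 0"
  shows "- \<gamma> * (norm v)\<^sup>2 \<le> inner v y + (norm y)\<^sup>2 / (4 * \<gamma>)"
proof -
  have "0 \<le> (norm (y + (2 * \<gamma>) *\<^sub>R v))\<^sup>2 / (4 * \<gamma>)" using assms by simp
  also have "\<dots> = (norm y)\<^sup>2 / (4 * \<gamma>) + inner v y + \<gamma> * (norm v)\<^sup>2"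
    using assms unfolding power2_norm_eq_inner
    by (simp add: inner_add_left inner_add_right inner_commute field_simps)
  finally show ?thesis by simp
qed

text \<open>Since \<open>prox\<close> is a definite description, existence and uniqueness have to
  come first. The subgradient \<open>v\<close> supplies an affine minorant of \<open>R\<close>,
  which makes the prox objective coercive and bounded below; monotonicity of the subdifferential
  gives uniqueness.\<close>

lemma prox_subgradient:
  fixes R :: "'a::euclidean_space \<Rightarrow> real"
  assumes pcc: "proper_closed_convex R D" and \<gamma>: "\<gamma> > 0" and minorant: "v \<in> subdiff R D z"
  shows "(1 / \<gamma>) *\<^sub>R (x - prox \<gamma> R D x) \<in> subdiff R D (prox \<gamma> R D x)"
proof -
  let ?H = "\<lambda>y. 1 / (2 * \<gamma>) * (norm (x - y))\<^sup>2"
  let ?P = "\<lambda>p. p \<in> D \<and> (\<forall>y\<in>D. \<gamma> * R p + (norm (x - p))\<^sup>2 / 2 \<le> \<gamma> * R y + (norm (x - y))\<^sup>2 / 2)"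
  have cl: "closed (epigraph R D)" and cv: "convex (epigraph R D)"
    using pcc by (auto simp: proper_closed_convex_def)
  have z: "z \<in> D" "\<And>y. y \<in> D \<Longrightarrow> R y \<ge> R z + inner v (y - z)"
    using minorant by (auto simp: subdiff_def)
  have scale: "\<gamma> * R p + (norm (x - p))\<^sup>2 / 2 = \<gamma> * (?H p + R p)" for p
    using \<gamma> by (simp add: field_simps)
  have P_iff: "?P p \<longleftrightarrow> p \<in> D \<and> (\<forall>y\<in>D. ?H p + R p \<le> ?H y + R y)" for p
    unfolding scale using \<gamma> by simp
  have sub: "(1 / \<gamma>) *\<^sub>R (x - p) \<in> subdiff R D p" if "?P p" for p
  proof -
    have "- ((2 * (1 / (2 * \<gamma>))) *\<^sub>R (p - x)) \<in> subdiff R D p"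
      using that unfolding P_iff
      by (intro minimizer_imp_subgradient[OF cv, where H = ?H] GDERIV_sq_dist) auto
    then show ?thesis using \<gamma> by (simp add: algebra_simps)
  qed
  \<comment> \<open>A lower bound for the affine minorant plus half of the quadratic term; the other
    half survives in \<open>low\<close> and bounds the sublevel set.\<close>
  define l where "l = R z + inner v (x - z) - \<gamma> * (norm v)\<^sup>2"
  have low: "l + (norm (x - y))\<^sup>2 / (4 * \<gamma>) \<le> ?H y + R y" if y: "y \<in> D" for y
  proof -
    have "- \<gamma> * (norm v)\<^sup>2 \<le> inner v (y - x) + (norm (y - x))\<^sup>2 / (4 * \<gamma>)"
      by (rule norm_le_quadratic_bound[OF \<gamma>])
    moreover have "inner v (y - x) + inner v (x - z) = inner v (y - z)"
      by (simp add: algebra_simps)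
    moreover have "?H y = (norm (y - x))\<^sup>2 / (4 * \<gamma>) + (norm (y - x))\<^sup>2 / (4 * \<gamma>)"
      using \<gamma> by (simp add: norm_minus_commute field_simps)
    ultimately show ?thesis using z(2)[OF y] by (simp add: l_def norm_minus_commute)
  qed
  have "{y \<in> D. ?H y + R y \<le> ?H z + R z} \<subseteq> cball x (sqrt (4 * \<gamma> * (?H z + R z - l)))"
  proof
    fix y assume y: "y \<in> {y \<in> D. ?H y + R y \<le> ?H z + R z}"
    then have "(norm (x - y))\<^sup>2 / (4 * \<gamma>) \<le> ?H z + R z - l" using low[of y] by auto
    then have "(norm (x - y))\<^sup>2 \<le> 4 * \<gamma> * (?H z + R z - l)"
      using \<gamma> by (simp only: pos_divide_le_eq mult_pos_pos zero_less_numeral ac_simps)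
    then show "y \<in> cball x (sqrt (4 * \<gamma> * (?H z + R z - l)))"
      by (simp add: dist_norm real_le_rsqrt)
  qed
  then have bdd: "bounded {y \<in> D. ?H y + R y \<le> ?H z + R z}"
    using bounded_cball bounded_subset by blast
  have cont: "continuous_on UNIV ?H" by (intro continuous_intros)
  have lower: "l \<le> ?H y + R y" if "y \<in> D" for y
  proof -
    have "0 \<le> (norm (x - y))\<^sup>2 / (4 * \<gamma>)" using \<gamma> by simp
    then show ?thesis using low[OF that] by linarith
  qed
  obtain p where p: "?P p"
    unfolding P_iff using closed_epigraph_attains_min[OF cl z(1) cont lower bdd] by metis
  \<comment> \<open>Both points carry the subgradient given by \<open>sub\<close>, and monotonicity
    turns into \<open>- (norm (q - p))^2 / \<gamma> \<ge> 0\<close>.\<close>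
  have uniq: "q = p" if q: "?P q" for q
  proof -
    have "0 \<le> inner ((1 / \<gamma>) *\<^sub>R (x - q) - (1 / \<gamma>) *\<^sub>R (x - p)) (q - p)"
      by (intro subdiff_monotone[of _ R D] sub q p)
    also have "(1 / \<gamma>) *\<^sub>R (x - q) - (1 / \<gamma>) *\<^sub>R (x - p) = (- 1 / \<gamma>) *\<^sub>R (q - p)"
      by (simp add: algebra_simps)
    finally have "(norm (q - p))\<^sup>2 \<le> 0"
      using \<gamma> by (simp only: inner_scaleR_left power2_norm_eq_inner[symmetric]) (simp add: mult_le_0_iff divide_le_0_iff)
    then show ?thesis by simp
  qed
  have "?P (prox \<gamma> R D x)"
    unfolding prox_def by (rule theI[of ?P p]) (use p uniq in blast)+
  then show ?thesis by (rule sub)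
qed

text \<open>Monotonicity of the subdifferential followed by Cauchy-Schwarz. It serves to make
  \<open>prox\<close> Borel measurable.\<close>

lemma prox_nonexpansive:
  fixes R :: "'a::euclidean_space \<Rightarrow> real"
  assumes "proper_closed_convex R D" and \<gamma>: "\<gamma> > 0" and "v \<in> subdiff R D z"
  shows "norm (prox \<gamma> R D x - prox \<gamma> R D y) \<le> norm (x - y)"
proof -
  let ?p = "prox \<gamma> R D x" and ?q = "prox \<gamma> R D y"
  have "0 \<le> inner ((1 / \<gamma>) *\<^sub>R (x - ?p) - (1 / \<gamma>) *\<^sub>R (y - ?q)) (?p - ?q)"
    by (intro subdiff_monotone[of _ R D] prox_subgradient[OF assms])
  also have "\<dots> = (inner (x - y) (?p - ?q) - (norm (?p - ?q))\<^sup>2) / \<gamma>"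
    by (simp add: power2_norm_eq_inner inner_diff_left inner_diff_right diff_divide_distrib add_divide_distrib)
  finally have "(norm (?p - ?q))\<^sup>2 \<le> inner (x - y) (?p - ?q)"
    using \<gamma> by (simp add: zero_le_divide_iff)
  also have "\<dots> \<le> norm (x - y) * norm (?p - ?q)" by (rule norm_cauchy_schwarz)
  finally have "norm (?p - ?q) * norm (?p - ?q) \<le> norm (x - y) * norm (?p - ?q)"
    by (simp add: power2_eq_square)
  then show ?thesis
    by (metis mult_right_le_imp_le norm_ge_zero order_le_less)
qed

section \<open>Descent lemma and tangent inequality\<close>

text \<open>The difference of the two sides along the segment is nonincreasing: its derivative is at
  most 0 by Cauchy-Schwarz and the Lipschitz bound. No integral of the gradient is needed.\<close>

lemma smooth_upper_bound:
  assumes grad: "\<And>x. GDERIV F x :> gF x"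
    and smooth: "\<And>x y. norm (gF x - gF y) \<le> L * norm (x - y)"
  shows "F y \<le> F x + inner (gF x) (y - x) + L / 2 * (norm (y - x))\<^sup>2"
proof -
  let ?d = "y - x"
  define \<phi> where "\<phi> t = F (x + t *\<^sub>R ?d) - t * inner (gF x) ?d - L / 2 * t\<^sup>2 * (norm ?d)\<^sup>2" for t
  have "\<phi> 1 \<le> \<phi> 0"
  proof (rule DERIV_nonpos_imp_nonincreasing[of 0 1 \<phi>])
    fix t :: real assume t: "0 \<le> t" "t \<le> 1"
    let ?s = "inner (gF (x + t *\<^sub>R ?d)) ?d - inner (gF x) ?d - L * t * (norm ?d)\<^sup>2"
    have deriv: "(\<phi> has_real_derivative ?s) (at t)"
      unfolding \<phi>_def by (auto intro!: derivative_eq_intros GDERIV_along_line grad)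
    have "inner (gF (x + t *\<^sub>R ?d)) ?d - inner (gF x) ?d \<le> norm (gF (x + t *\<^sub>R ?d) - gF x) * norm ?d"
      by (metis inner_diff_left norm_cauchy_schwarz)
    also have "\<dots> \<le> (L * norm (x + t *\<^sub>R ?d - x)) * norm ?d"
      by (intro mult_right_mono smooth) auto
    also have "\<dots> = L * t * (norm ?d)\<^sup>2"
      using t by (simp add: power2_eq_square)
    finally show "\<exists>s. (\<phi> has_real_derivative s) (at t) \<and> s \<le> 0"
      by (intro exI[of _ ?s] conjI deriv) simp
  qed simp
  then show ?thesis by (simp add: \<phi>_def)
qed

text \<open>With \<open>H = - F\<close> and \<open>R = F\<close> the objective is constantly 0, so
  every point is a minimizer and first-order optimality yields the tangent inequality.\<close>

lemma convex_on_UNIV_tangent: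
  fixes F :: "'a::euclidean_space \<Rightarrow> real"
  assumes "convex_on UNIV F" and grad: "GDERIV F x :> g"
  shows "F x + inner g (y - x) \<le> F y"
proof -
  have "epigraph F UNIV = Convex.epigraph UNIV F"
    by (auto simp: epigraph_def Convex.epigraph_def)
  then have "convex (epigraph F UNIV)"
    using assms(1) convex_epigraph by metis
  then have "- (- g) \<in> subdiff F UNIV x"
    by (rule minimizer_imp_subgradient[where H = "\<lambda>x. - F x"]) (use grad GDERIV_minus in auto)
  then show ?thesis by (simp add: subdiff_def)
qed

section \<open>Deterministic analysis of one inexact proximal gradient step\<close>

locale smooth_composite =
  fixes F :: "'a::euclidean_space \<Rightarrow> real" and gF :: "'a \<Rightarrow> 'a" and L :: real
    and R :: "'a \<Rightarrow> real" and D :: "'a set" and xstar :: 'a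
  assumes F_grad: "GDERIV F x :> gF x"
    and F_convex: "convex_on UNIV F"
    and F_smooth: "norm (gF x - gF y) \<le> L * norm (x - y)"
    and R_pcc: "proper_closed_convex R D"
    and xstar_D: "xstar \<in> D"
    and xstar_min: "x \<in> D \<Longrightarrow> F xstar + R xstar \<le> F x + R x"
begin

abbreviation gap :: "'a \<Rightarrow> real" where
  "gap x \<equiv> F x + R x - F xstar - R xstar"

lemma gap_nonneg: "x \<in> D \<Longrightarrow> 0 \<le> gap x"
  using xstar_min by (simp add: algebra_simps)

lemma closed_epi: "closed (epigraph R D)" and convex_epi: "convex (epigraph R D)"
  using R_pcc by (auto simp: proper_closed_convex_def)

text \<open>Provides the affine minorant of \<open>R\<close> on which the facts about
  \<open>prox\<close> rest.\<close>

lemma xstar_subgradient: "- gF xstar \<in> subdiff R D xstar"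
  by (rule minimizer_imp_subgradient[OF convex_epi xstar_D xstar_min F_grad])

lemmas prox_subgradient' = prox_subgradient[OF R_pcc _ xstar_subgradient]
lemmas prox_nonexpansive' = prox_nonexpansive[OF R_pcc _ xstar_subgradient]

lemma prox_in_D: "\<gamma> > 0 \<Longrightarrow> prox \<gamma> R D x \<in> D"
  using prox_subgradient' by (auto simp: subdiff_def)

lemma isCont_F: "isCont F x"
  using F_grad by (meson GDERIV_DERIV_compose gderiv_def has_derivative_continuous)

lemma F_tangent: "F x + inner (gF x) (y - x) \<le> F y"
  by (rule convex_on_UNIV_tangent[OF F_convex F_grad])

text \<open>The minimum of \<open>F + R\<close> bounds the regularized objective from below and
  keeps its sublevel set in a ball of radius \<open>sqrt (gap x / c)\<close>. First-order optimality
  is implicit: the gradient is taken at \<open>p\<close>, not at \<open>x\<close>.\<close>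

lemma proximal_point_exists:
  assumes c: "c > 0" and x: "x \<in> D"
  obtains p where "p \<in> D" "(2 * c) *\<^sub>R (x - p) - gF p \<in> subdiff R D p"
proof -
  let ?H = "\<lambda>y. F y + c * (norm (x - y))\<^sup>2"
  have low: "F xstar + R xstar + c * (norm (x - y))\<^sup>2 \<le> ?H y + R y" if "y \<in> D" for y
    using xstar_min[OF that] by simp
  have "{y \<in> D. ?H y + R y \<le> ?H x + R x} \<subseteq> cball x (sqrt (gap x / c))"
  proof
    fix y assume y: "y \<in> {y \<in> D. ?H y + R y \<le> ?H x + R x}"
    then have "c * (norm (x - y))\<^sup>2 \<le> gap x" using low[of y] by auto
    then have "(norm (x - y))\<^sup>2 \<le> gap x / c" using c by (simp add: field_simps)
    then show "y \<in> cball x (sqrt (gap x / c))" by (simp add: dist_norm real_le_rsqrt)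
  qed
  then have bdd: "bounded {y \<in> D. ?H y + R y \<le> ?H x + R x}"
    using bounded_cball bounded_subset by blast
  have cont: "continuous_on UNIV ?H"
    by (intro continuous_intros continuous_at_imp_continuous_on ballI isCont_F)
  have lower: "F xstar + R xstar \<le> ?H y + R y" if "y \<in> D" for y
    using low[OF that] mult_nonneg_nonneg[OF less_imp_le[OF c] zero_le_power2[of "norm (x - y)"]] by linarith
  obtain p where p: "p \<in> D" "\<And>y. y \<in> D \<Longrightarrow> ?H p + R p \<le> ?H y + R y"
    using closed_epigraph_attains_min[OF closed_epi x cont lower bdd] by blast
  have "- (gF p + (2 * c) *\<^sub>R (p - x)) \<in> subdiff R D p"
    by (rule minimizer_imp_subgradient[OF convex_epi p])
       (simp_all add: GDERIV_add F_grad GDERIV_sq_dist)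
  then show ?thesis
    using that p(1) by (simp add: algebra_simps)
qed

lemma moreau_envelope_contraction:
  assumes KL: "\<And>x u. u \<in> subdiff R D x \<Longrightarrow> (norm (gF x + u))\<^sup>2 \<ge> 2 * \<mu> * gap x"
    and \<gamma>: "\<gamma> > 0" and K: "1 \<le> K" "K \<le> 2" "K \<le> 1 + \<gamma> * \<mu> / 2" and x: "x \<in> D"
  obtains p where "p \<in> D" "gap p + (norm (p - x))\<^sup>2 / (2 * \<gamma>) \<le> gap x / K"
proof -
  \<comment> \<open>The step size is \<open>\<gamma> / 2\<close>: the step \<open>\<gamma>\<close> gives the bound only for \<open>K \<le> 3 / 2\<close>.\<close>
  obtain p where p: "p \<in> D" "(2 * (1 / \<gamma>)) *\<^sub>R (x - p) - gF p \<in> subdiff R D p"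
    using proximal_point_exists[of "1 / \<gamma>" x] \<gamma> x by auto
  define q where "q = (norm (p - x))\<^sup>2 / \<gamma>"
  let ?v = "(2 / \<gamma>) *\<^sub>R (x - p)"
  \<comment> \<open>This subgradient is used twice: convexity from \<open>p\<close> to
    \<open>x\<close> gives \<open>decrease\<close>, and since \<open>gF p\<close> cancels, the KL
    inequality at \<open>p\<close> bounds \<open>gap p\<close> by the squared length of
    \<open>?v\<close>.\<close>
  have sub: "?v - gF p \<in> subdiff R D p" using p by simp
  then have "R x \<ge> R p + inner (?v - gF p) (x - p)" using x by (simp add: subdiff_def)
  moreover have "inner (?v - gF p) (x - p) = 2 * q - inner (gF p) (x - p)"
    by (simp add: q_def inner_diff_left power2_norm_eq_inner[symmetric] norm_minus_commute)
  ultimately have decrease: "gap p + 2 * q \<le> gap x"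
    using F_tangent[of p x] by simp
  have "2 * \<mu> * gap p \<le> (norm ?v)\<^sup>2" using KL[OF sub] by simp
  also have "\<dots> = 4 * q / \<gamma>"
    by (simp add: q_def norm_minus_commute power_mult_distrib power_divide) (simp add: power2_eq_square)
  finally have "(\<gamma> * \<mu> / 2) * gap p \<le> q" using \<gamma> by (simp add: field_simps)
  then have "(K - 1) * gap p \<le> q"
    using K(3) gap_nonneg[OF p(1)] mult_right_mono[of "K - 1" "\<gamma> * \<mu> / 2" "gap p"] by linarith
  moreover have "K * q \<le> 2 * q" using \<gamma> K by (intro mult_right_mono) (auto simp: q_def)
  \<comment> \<open>Of the decrease \<open>2 * q\<close>, one \<open>q\<close> pays for
    \<open>(K - 1) * gap p\<close> and the other for \<open>K * q / 2\<close>.\<close>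
  ultimately have "K * (gap p + q / 2) \<le> gap x"
    using decrease by (simp add: algebra_simps)
  then have "gap p + q / 2 \<le> gap x / K" using K by (simp add: field_simps)
  then show ?thesis using that p(1) by (simp add: q_def)
qed

text \<open>Comparing the inexact step with the proximal point of \<open>F + R\<close> itself, through convexity of
  \<open>F\<close>, keeps the coefficient of the squared step length independent of \<open>K\<close>. Applying the KL
  inequality at \<open>x'\<close> instead would divide that coefficient by \<open>K\<close>, and the given step size
  bound would not suffice.\<close>

lemma prox_gradient_step:
  fixes e :: 'a
  assumes KL: "\<And>x u. u \<in> subdiff R D x \<Longrightarrow> (norm (gF x + u))\<^sup>2 \<ge> 2 * \<mu> * gap x"
    and \<gamma>: "\<gamma> > 0" and K: "1 \<le> K" "K \<le> 2" "K \<le> 1 + \<gamma> * \<mu> / 2" and x: "x \<in> D"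
    and B: "\<gamma> * L + B \<le> 1"
    and x': "x' = prox \<gamma> R D (x - \<gamma> *\<^sub>R (gF x + e))"
  shows "gap x' + B / (2 * \<gamma>) * (norm (x' - x))\<^sup>2 \<le> gap x / K + \<gamma> / 2 * (norm e)\<^sup>2"
proof -
  obtain p where p: "p \<in> D" "gap p + (norm (p - x))\<^sup>2 / (2 * \<gamma>) \<le> gap x / K"
    using moreau_envelope_contraction[OF KL \<gamma> K x] by blast
  let ?w = "p - x'" and ?d = "x' - x"
  define u where "u = (1 / \<gamma>) *\<^sub>R (x - \<gamma> *\<^sub>R (gF x + e) - x')"
  have u: "u = - (1 / \<gamma>) *\<^sub>R ?d - gF x - e" using \<gamma> by (simp add: u_def algebra_simps)
  have "u \<in> subdiff R D x'" unfolding u_def x' by (rule prox_subgradient'[OF \<gamma>])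
  then have "R x' \<le> R p - inner u ?w" using p by (auto simp: subdiff_def)
  moreover have "inner u ?w = - inner ?d ?w / \<gamma> - inner (gF x) ?w - inner e ?w"
    by (simp add: u inner_diff_left diff_divide_distrib)
  \<comment> \<open>\<open>F x'\<close> is compared with \<open>F p\<close> through
    \<open>x\<close>: the descent lemma leads from \<open>x'\<close> to \<open>x\<close>, the
    tangent inequality from \<open>x\<close> to \<open>p\<close>. The \<open>gF x\<close> terms then
    cancel against those in \<open>inner u ?w\<close>.\<close>
  moreover have "F x' \<le> F x + inner (gF x) ?d + L / 2 * (norm ?d)\<^sup>2"
    by (rule smooth_upper_bound[OF F_grad F_smooth])
  moreover have "inner (gF x) (p - x) = inner (gF x) ?w + inner (gF x) ?d"
    by (simp add: algebra_simps)
  moreover have "F x + inner (gF x) (p - x) \<le> F p" by (rule F_tangent)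
  moreover have "L / 2 * (norm ?d)\<^sup>2 + B / (2 * \<gamma>) * (norm ?d)\<^sup>2 \<le> (norm ?d)\<^sup>2 / (2 * \<gamma>)"
  proof -
    have "L / 2 + B / (2 * \<gamma>) = (\<gamma> * L + B) / (2 * \<gamma>)" using \<gamma> by (simp add: field_simps)
    also have "\<dots> \<le> 1 / (2 * \<gamma>)" using B \<gamma> by (intro divide_right_mono) auto
    finally have "L / 2 + B / (2 * \<gamma>) \<le> 1 / (2 * \<gamma>)" .
    then show ?thesis
      using mult_right_mono[of "L / 2 + B / (2 * \<gamma>)" "1 / (2 * \<gamma>)" "(norm ?d)\<^sup>2"]
      by (simp add: distrib_right)
  qed
  moreover have "(norm (p - x))\<^sup>2 / (2 * \<gamma>) = (norm ?d)\<^sup>2 / (2 * \<gamma>) + inner ?d ?w / \<gamma> + (norm ?w)\<^sup>2 / (2 * \<gamma>)"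
  proof -
    have "(norm (p - x))\<^sup>2 = (norm ?d)\<^sup>2 + 2 * inner ?d ?w + (norm ?w)\<^sup>2"
      unfolding power2_norm_eq_inner by (simp add: algebra_simps inner_commute)
    then show ?thesis using \<gamma> by (simp add: field_simps)
  qed
  \<comment> \<open>The parameter \<open>\<gamma> / 2\<close> makes the cost exactly the
    \<open>(norm ?w)^2 / (2 * \<gamma>)\<close> available from the expansion of
    \<open>(norm (p - x))^2\<close>.\<close>
  moreover have "inner e ?w \<le> (norm ?w)\<^sup>2 / (2 * \<gamma>) + \<gamma> / 2 * (norm e)\<^sup>2"
    using norm_le_quadratic_bound[of "\<gamma> / 2" "- e" ?w] \<gamma> by simp
  ultimately show ?thesis using p(2) by linarith
qed

end

section \<open>Elementary inequalities and the constant \<open>s_star\<close>\<close>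

lemma norm_add_sq_le:
  fixes a b :: "'a::real_inner"
  assumes "s > 0"
  shows "(norm (a + b))\<^sup>2 \<le> (1 + s) * (norm a)\<^sup>2 + (1 + 1 / s) * (norm b)\<^sup>2"
proof -
  have "0 \<le> (norm (s *\<^sub>R a - b))\<^sup>2 / s" using assms by simp
  also have "\<dots> = s * (norm a)\<^sup>2 - 2 * inner a b + (1 / s) * (norm b)\<^sup>2"
    using assms unfolding power2_norm_eq_inner
    by (simp add: inner_diff_left inner_diff_right inner_commute field_simps)
  finally show ?thesis
    unfolding power2_norm_eq_inner
    by (simp add: algebra_simps inner_commute)
qed

text \<open>Triangle inequality, then Cauchy-Schwarz for the sum of norms. It controls the bias of
  an average of compressors.\<close>

lemma sq_norm_mean_le:
  fixes v :: "nat \<Rightarrow> 'a::real_normed_vector"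
  assumes "\<And>i. i < n \<Longrightarrow> norm (v i) \<le> c * norm (z i)" "0 \<le> c"
  shows "(norm ((1 / real n) *\<^sub>R (\<Sum>i<n. v i)))\<^sup>2 \<le> c\<^sup>2 * (1 / real n * (\<Sum>i<n. (norm (z i))\<^sup>2))"
proof -
  have "norm (\<Sum>i<n. v i) \<le> (\<Sum>i<n. c * norm (z i))"
    using assms by (intro sum_norm_le) auto
  then have "(norm (\<Sum>i<n. v i))\<^sup>2 \<le> (\<Sum>i<n. c * norm (z i))\<^sup>2"
    by (intro power_mono) auto
  also have "\<dots> = c\<^sup>2 * (\<Sum>i<n. norm (z i))\<^sup>2"
    by (simp add: sum_distrib_left[symmetric] power_mult_distrib)
  also have "\<dots> \<le> c\<^sup>2 * (real n * (\<Sum>i<n. (norm (z i))\<^sup>2))"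
    using sum_squared_le_sum_of_squares[of "\<lambda>i. norm (z i)" "{..<n}"]
    by (intro mult_left_mono) (auto simp: mult.commute)
  finally have "(norm (\<Sum>i<n. v i))\<^sup>2 \<le> c\<^sup>2 * (real n * (\<Sum>i<n. (norm (z i))\<^sup>2))" .
  then show ?thesis
    by (cases "n = 0") (auto simp: power_divide power2_eq_square field_simps)
qed

lemma s_star_pos:
  assumes "0 < r" "r < 1"
  shows "0 < s_star r"
proof -
  have "1 < (1 + r) / (2 * r)" using assms by (simp add: field_simps)
  then show ?thesis by (simp add: s_star_def)
qed

text \<open>The property for which \<open>s_star\<close> is chosen: inflating \<open>r\<close> by
  \<open>(1 + s)^2\<close> ends halfway between \<open>r\<close> and 1.\<close>

lemma s_star_sq:
  assumes "0 < r"
  shows "(1 + s_star r)\<^sup>2 * r = (1 + r) / 2"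
  using assms by (simp add: s_star_def)

section \<open>Bias-variance decomposition and integration under independence\<close>

text \<open>Expand around the mean; the cross term has expectation 0. The finite bound on the
  variance also yields the square integrability that the expansion requires.\<close>

lemma (in prob_space) nn_integral_sq_dist_le:
  fixes Y :: "'a \<Rightarrow> 'b::euclidean_space"
  assumes int: "integrable M Y" and v: "0 \<le> v"
    and var: "(\<integral>\<^sup>+w. ennreal ((norm (Y w - expectation Y))\<^sup>2) \<partial>M) \<le> ennreal v"
  shows "(\<integral>\<^sup>+w. ennreal ((norm (Y w - c))\<^sup>2) \<partial>M) \<le> ennreal (v + (norm (expectation Y - c))\<^sup>2)"
proof -
  let ?m = "expectation Y"
  have [measurable]: "Y \<in> borel_measurable M" using int by auto
  have sq: "integrable M (\<lambda>w. (norm (Y w - ?m))\<^sup>2)"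
    using var by (intro integrableI_bounded) (auto simp: less_top[symmetric] top_unique dest: order_le_less_trans)
  have lin: "integrable M (\<lambda>w. inner (Y w - ?m) (?m - c))"
    using int by (intro integrable_inner_left) auto
  have expand: "(norm (Y w - c))\<^sup>2 = (norm (Y w - ?m))\<^sup>2 + 2 * inner (Y w - ?m) (?m - c) + (norm (?m - c))\<^sup>2" for w
    unfolding power2_norm_eq_inner by (simp add: algebra_simps inner_commute)
  have "expectation (\<lambda>w. inner (Y w - ?m) (?m - c)) = inner (expectation (\<lambda>w. Y w - ?m)) (?m - c)"
    using int by (intro integral_inner_left) auto
  then have lin0: "expectation (\<lambda>w. inner (Y w - ?m) (?m - c)) = 0"
    using int by (simp add: prob_space)
  have "expectation (\<lambda>w. (norm (Y w - ?m))\<^sup>2) \<le> v"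
    using var v by (simp add: nn_integral_eq_integral[OF sq])
  then have "expectation (\<lambda>w. (norm (Y w - c))\<^sup>2) \<le> v + (norm (?m - c))\<^sup>2"
    unfolding expand using sq lin lin0 by (simp add: prob_space)
  moreover have "integrable M (\<lambda>w. (norm (Y w - c))\<^sup>2)"
    unfolding expand using sq lin by auto
  ultimately show ?thesis
    by (simp add: nn_integral_eq_integral ennreal_leI)
qed

text \<open>The joint law is a product, so Tonelli applies. This takes the place of conditional
  expectation given \<open>X\<close>.\<close>

lemma (in prob_space) nn_integral_indep_iterate:
  assumes indep: "indep_var S X T Y" and B: "B \<in> borel_measurable (S \<Otimes>\<^sub>M T)"
  shows "(\<integral>\<^sup>+w. B (X w, Y w) \<partial>M) = (\<integral>\<^sup>+w. (\<integral>\<^sup>+v. B (X w, Y v) \<partial>M) \<partial>M)"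
proof -
  have X[measurable]: "random_variable S X" and Y[measurable]: "random_variable T Y"
    and eq: "distr M S X \<Otimes>\<^sub>M distr M T Y = distr M (S \<Otimes>\<^sub>M T) (\<lambda>x. (X x, Y x))"
    using indep by (auto simp: indep_var_distribution_eq)
  interpret Y: prob_space "distr M T Y" by (rule prob_space_distr) fact
  have [measurable]: "(\<lambda>s. \<integral>\<^sup>+t. B (s, t) \<partial>distr M T Y) \<in> borel_measurable S"
    using B by measurable
  have "(\<integral>\<^sup>+w. B (X w, Y w) \<partial>M) = (\<integral>\<^sup>+z. B z \<partial>(distr M S X \<Otimes>\<^sub>M distr M T Y))"
    unfolding eq using B by (subst nn_integral_distr) auto
  also have "\<dots> = (\<integral>\<^sup>+s. (\<integral>\<^sup>+t. B (s, t) \<partial>distr M T Y) \<partial>distr M S X)"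
    using B by (intro Y.nn_integral_fst[symmetric]) simp
  also have "\<dots> = (\<integral>\<^sup>+w. (\<integral>\<^sup>+t. B (X w, t) \<partial>distr M T Y) \<partial>M)"
    by (subst nn_integral_distr) auto
  also have "\<dots> = (\<integral>\<^sup>+w. (\<integral>\<^sup>+v. B (X w, Y v) \<partial>M) \<partial>M)"
    using B measurable_space[OF X]
    by (intro nn_integral_cong nn_integral_distr) auto
  finally show ?thesis .
qed

section \<open>DIANA iterates as functions of the past randomness\<close>

lemma diana_fst_Suc:
  "fst (diana n gf Cmp \<xi> R D \<gamma> lam x0 h0 (Suc t) w) =
    (let (x, h) = diana n gf Cmp \<xi> R D \<gamma> lam x0 h0 t w in
     prox \<gamma> R D (x - \<gamma> *\<^sub>R ((1 / real n) *\<^sub>R (\<Sum>i<n. h i) +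
       (1 / real n) *\<^sub>R (\<Sum>i<n. Cmp t i (\<xi> t w) (gf i x - h i)))))"
  by (simp add: Let_def case_prod_beta)

lemma diana_snd_Suc:
  "snd (diana n gf Cmp \<xi> R D \<gamma> lam x0 h0 (Suc t) w) i =
    (let (x, h) = diana n gf Cmp \<xi> R D \<gamma> lam x0 h0 t w in
     h i + lam *\<^sub>R Cmp t i (\<xi> t w) (gf i x - h i))"
  by (simp add: Let_def case_prod_beta)

lemma diana_cong:
  assumes "\<And>k. k < t \<Longrightarrow> \<xi> k w = \<xi>' k w'"
  shows "diana n gf Cmp \<xi> R D \<gamma> lam x0 h0 t w = diana n gf Cmp \<xi>' R D \<gamma> lam x0 h0 t w'"
  using assms by (induction t) (simp_all add: Let_def case_prod_beta)

text \<open>The noise is the coordinate process on a product space. The index set \<open>A\<close>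
  need only contain \<open>{..<t}\<close>, so the induction on \<open>t\<close> stays in one
  space.\<close>

lemma diana_measurable:
  fixes Cmp :: "nat \<Rightarrow> nat \<Rightarrow> 'b \<Rightarrow> 'a \<Rightarrow> 'a::euclidean_space"
    and lam :: real and x0 :: 'a and h0 :: "nat \<Rightarrow> 'a"
  assumes prox[measurable]: "prox \<gamma> R D \<in> borel_measurable borel"
    and gf: "\<And>i. i < n \<Longrightarrow> gf i \<in> borel_measurable borel"
    and Cmp: "\<And>t i. (\<lambda>(z, x). Cmp t i z x) \<in> borel_measurable (N \<Otimes>\<^sub>M borel)"
    and A: "{..<t} \<subseteq> A"
  defines "X \<equiv> diana n gf Cmp (\<lambda>k \<omega>. \<omega> k) R D \<gamma> lam x0 h0"
  shows "(\<lambda>\<omega>. fst (X t \<omega>)) \<in> borel_measurable (PiM A (\<lambda>_. N))"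
    and "\<And>i. i < n \<Longrightarrow> (\<lambda>\<omega>. snd (X t \<omega>) i) \<in> borel_measurable (PiM A (\<lambda>_. N))"
  using A
proof (induction t)
  case 0
  { case 1 show ?case by (simp add: X_def) }
  { case 2 show ?case by (simp add: X_def) }
next
  case (Suc t)
  let ?P = "PiM A (\<lambda>_. N)"
  let ?C = "\<lambda>i \<omega>. Cmp t i (\<omega> t) (gf i (fst (X t \<omega>)) - snd (X t \<omega>) i)"
  have C: "?C i \<in> borel_measurable ?P" if "{..<Suc t} \<subseteq> A" "i < n" for i
  proof -
    have "{..<t} \<subseteq> A" using that by auto
    have "(\<lambda>\<omega>. \<omega> t) \<in> measurable ?P N"
      using that by (intro measurable_component_singleton) auto
    moreover have "(\<lambda>\<omega>. gf i (fst (X t \<omega>)) - snd (X t \<omega>) i) \<in> borel_measurable ?P"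
      using Suc that(2) \<open>{..<t} \<subseteq> A\<close> by (intro borel_measurable_diff measurable_compose[OF _ gf]) auto
    ultimately show ?thesis
      using measurable_compose[OF measurable_Pair Cmp, of "\<lambda>\<omega>. \<omega> t" ?P] by simp
  qed
  { case 1
    then have A': "{..<t} \<subseteq> A" by auto
    have sums: "(\<lambda>\<omega>. \<Sum>i<n. snd (X t \<omega>) i) \<in> borel_measurable ?P" "(\<lambda>\<omega>. \<Sum>i<n. ?C i \<omega>) \<in> borel_measurable ?P"
      using Suc.IH(2)[OF _ A'] C[OF 1] by (auto intro!: borel_measurable_sum)
    have "(\<lambda>\<omega>. fst (X t \<omega>) - \<gamma> *\<^sub>R ((1 / real n) *\<^sub>R (\<Sum>i<n. snd (X t \<omega>) i) +
        (1 / real n) *\<^sub>R (\<Sum>i<n. ?C i \<omega>))) \<in> borel_measurable ?P"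
      by (intro borel_measurable_diff borel_measurable_scaleR borel_measurable_add
          borel_measurable_const Suc.IH(1)[OF A'] sums)
    from measurable_compose[OF this prox] show ?case
      unfolding X_def diana_fst_Suc Let_def case_prod_beta . }
  { case 2
    then have A': "{..<t} \<subseteq> A" by auto
    have "(\<lambda>\<omega>. snd (X t \<omega>) i + lam *\<^sub>R ?C i \<omega>) \<in> borel_measurable ?P"
      by (intro borel_measurable_add borel_measurable_scaleR borel_measurable_const
          Suc.IH(2)[OF 2(1) A'] C[OF 2(2,1)])
    then show ?case
      unfolding X_def diana_snd_Suc Let_def case_prod_beta . }
qed

text \<open>The state at time \<open>t\<close> depends only on the noise block
  \<open>{..<t}\<close>, which is independent of the block \<open>{t}\<close>; hence the fresh noise
  may be integrated out with the state frozen.\<close>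

lemma (in prob_space) nn_integral_diana_iterate:
  fixes Cmp :: "nat \<Rightarrow> nat \<Rightarrow> 'b \<Rightarrow> 'c \<Rightarrow> 'c::euclidean_space"
    and lam :: real and x0 :: 'c and h0 :: "nat \<Rightarrow> 'c"
  assumes "prox \<gamma> R D \<in> borel_measurable borel"
    and "\<And>i. i < n \<Longrightarrow> gf i \<in> borel_measurable borel"
    and "\<And>t i. (\<lambda>(z, x). Cmp t i z x) \<in> borel_measurable (N \<Otimes>\<^sub>M borel)"
    and \<xi>: "indep_vars (\<lambda>_. N) \<xi> UNIV"
    and B: "B \<in> borel_measurable ((borel \<Otimes>\<^sub>M PiM {..<n} (\<lambda>_. borel)) \<Otimes>\<^sub>M N)"
  defines "X \<equiv> (\<lambda>t w. case diana n gf Cmp \<xi> R D \<gamma> lam x0 h0 t w of (x, h) \<Rightarrow> (x, restrict h {..<n}))"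
  shows "X t \<in> measurable M (borel \<Otimes>\<^sub>M PiM {..<n} (\<lambda>_. borel))"
    and "(\<integral>\<^sup>+w. B (X t w, \<xi> t w) \<partial>M) = (\<integral>\<^sup>+w. (\<integral>\<^sup>+v. B (X t w, \<xi> t v) \<partial>M) \<partial>M)"
proof -
  let ?P = "\<lambda>A. PiM A (\<lambda>_. N)"
  let ?S = "borel \<Otimes>\<^sub>M PiM {..<n} (\<lambda>_. borel)"
  define Y where "Y \<omega> = (case diana n gf Cmp (\<lambda>k \<omega>. \<omega> k) R D \<gamma> lam x0 h0 t \<omega> of (x, h) \<Rightarrow> (x, restrict h {..<n}))" for \<omega>
  have indep: "indep_var (?P {..<t}) (\<lambda>w. restrict (\<lambda>k. \<xi> k w) {..<t}) (?P {t}) (\<lambda>w. restrict (\<lambda>k. \<xi> k w) {t})"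
    by (rule indep_var_restrict[OF \<xi>]) auto
  have Y: "Y \<in> measurable (?P {..<t}) ?S"
    using diana_measurable[of \<gamma> R D n gf Cmp N t "{..<t}", OF assms(1-3)]
    unfolding Y_def case_prod_beta by (intro measurable_Pair measurable_restrict) auto
  have "(\<lambda>\<omega>. \<omega> t) \<in> measurable (?P {t}) N"
    by (intro measurable_component_singleton) auto
  with Y have "(\<lambda>z. (Y (fst z), snd z t)) \<in> measurable (?P {..<t} \<Otimes>\<^sub>M ?P {t}) (?S \<Otimes>\<^sub>M N)"
    by (intro measurable_Pair measurable_compose[OF measurable_fst] measurable_compose[OF measurable_snd])
  then have BY: "(\<lambda>z. B (Y (fst z), snd z t)) \<in> borel_measurable (?P {..<t} \<Otimes>\<^sub>M ?P {t})"
    by (rule measurable_compose[OF _ B])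
  have eq: "Y (restrict (\<lambda>k. \<xi> k w) {..<t}) = X t w" for w
    unfolding X_def Y_def by (subst diana_cong[where \<xi>' = \<xi> and w' = w]) auto
  show "X t \<in> measurable M ?S"
    using measurable_compose[OF indep_var_rv1[OF indep] Y] by (simp add: eq)
  show "(\<integral>\<^sup>+w. B (X t w, \<xi> t w) \<partial>M) = (\<integral>\<^sup>+w. (\<integral>\<^sup>+v. B (X t w, \<xi> t v) \<partial>M) \<partial>M)"
    using nn_integral_indep_iterate[OF indep BY] by (simp add: eq)
qed

section \<open>Borel measurability of \<open>R\<close>, its domain and Lipschitz maps\<close>

text \<open>Sublevel sets are horizontal sections of the epigraph, hence closed, and
  \<open>D\<close> is their union over integer levels.\<close>

lemma closed_epigraph_measurable:
  fixes R :: "'a::euclidean_space \<Rightarrow> real"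
  assumes "closed (epigraph R D)"
  shows "D \<in> sets borel" "(\<lambda>x. if x \<in> D then R x else 0) \<in> borel_measurable borel"
proof -
  have sub: "{x \<in> D. R x \<le> c} \<in> sets borel" for c
  proof -
    have "closed ((\<lambda>x. (x, c)) -` epigraph R D)"
      by (intro closed_vimage assms continuous_intros)
    then show ?thesis by (simp add: epigraph_def vimage_def)
  qed
  have "D = (\<Union>k::nat. {x \<in> D. R x \<le> real k})"
    using real_arch_simple by auto
  also have "\<dots> \<in> sets borel" by (intro sets.countable_UN) (use sub in auto)
  finally show D: "D \<in> sets borel" .
  have "{x. (if x \<in> D then R x else 0) \<le> c} = {x \<in> D. R x \<le> c} \<union> (if 0 \<le> c then - D else {})" for c
    by auto
  then show "(\<lambda>x. if x \<in> D then R x else 0) \<in> borel_measurable borel"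
    unfolding borel_measurable_iff_le using sub[THEN sets.Un] D by (simp add: borel_comp)
qed

lemma lipschitz_imp_borel_measurable:
  fixes g :: "'a::euclidean_space \<Rightarrow> 'b::euclidean_space"
  assumes "\<And>x y. norm (g x - g y) \<le> c * norm (x - y)" "0 \<le> c"
  shows "g \<in> borel_measurable borel"
proof -
  have "c-lipschitz_on UNIV g" by (rule lipschitz_onI) (use assms in \<open>auto simp: dist_norm\<close>)
  then show ?thesis
    by (intro borel_measurable_continuous_onI lipschitz_on_continuous_on)
qed

section \<open>Second moments of the compression errors\<close>

text \<open>Scaling by \<open>lam\<close> contributes \<open>lam^2 * \<omega>\<close> to the
  variance, and the mean of \<open>lam Y - z\<close> splits into \<open>lam (E Y - z)\<close> and
  \<open>- (1 - lam) z\<close>; together they make up \<open>diana_r\<close>.\<close>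

lemma (in prob_space) nn_integral_shift_error_le:
  fixes Y :: "'a \<Rightarrow> 'b::euclidean_space"
  assumes int: "integrable M Y" and bias: "norm (expectation Y - z) \<le> \<eta> * norm z"
    and var: "(\<integral>\<^sup>+w. ennreal ((norm (Y w - expectation Y))\<^sup>2) \<partial>M) \<le> ennreal (\<omega> * (norm z)\<^sup>2)"
    and "0 \<le> \<omega>" "0 \<le> lam" "lam \<le> 1"
  shows "(\<integral>\<^sup>+w. ennreal ((norm (lam *\<^sub>R Y w - z))\<^sup>2) \<partial>M) \<le> ennreal (diana_r \<eta> \<omega> lam * (norm z)\<^sup>2)"
proof -
  have [measurable]: "Y \<in> borel_measurable M" using int by auto
  let ?m = "expectation Y"
  have "ennreal ((norm (lam *\<^sub>R Y w - expectation (\<lambda>w. lam *\<^sub>R Y w)))\<^sup>2)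
      = ennreal (lam\<^sup>2) * ennreal ((norm (Y w - ?m))\<^sup>2)" for w
  proof -
    have "lam *\<^sub>R Y w - expectation (\<lambda>w. lam *\<^sub>R Y w) = lam *\<^sub>R (Y w - ?m)"
      by (simp add: scaleR_diff_right)
    then show ?thesis by (simp add: power_mult_distrib ennreal_mult)
  qed
  then have "(\<integral>\<^sup>+w. ennreal ((norm (lam *\<^sub>R Y w - expectation (\<lambda>w. lam *\<^sub>R Y w)))\<^sup>2) \<partial>M)
      = (\<integral>\<^sup>+w. ennreal (lam\<^sup>2) * ennreal ((norm (Y w - ?m))\<^sup>2) \<partial>M)"
    by simp
  also have "\<dots> = ennreal (lam\<^sup>2) * (\<integral>\<^sup>+w. ennreal ((norm (Y w - ?m))\<^sup>2) \<partial>M)"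
    by (intro nn_integral_cmult) simp
  also have "\<dots> \<le> ennreal (lam\<^sup>2) * ennreal (\<omega> * (norm z)\<^sup>2)"
    by (intro mult_left_mono var) simp
  also have "\<dots> = ennreal (lam\<^sup>2 * (\<omega> * (norm z)\<^sup>2))"
    using assms by (simp add: ennreal_mult)
  finally have "(\<integral>\<^sup>+w. ennreal ((norm (lam *\<^sub>R Y w - z))\<^sup>2) \<partial>M)
      \<le> ennreal (lam\<^sup>2 * (\<omega> * (norm z)\<^sup>2) + (norm (expectation (\<lambda>w. lam *\<^sub>R Y w) - z))\<^sup>2)"
    using assms by (intro nn_integral_sq_dist_le) auto
  also have "(norm (expectation (\<lambda>w. lam *\<^sub>R Y w) - z))\<^sup>2 \<le> ((1 - lam + lam * \<eta>) * norm z)\<^sup>2"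
  proof (rule power_mono)
    have "expectation (\<lambda>w. lam *\<^sub>R Y w) - z = lam *\<^sub>R (?m - z) - (1 - lam) *\<^sub>R z"
      by (simp add: algebra_simps)
    also have "norm \<dots> \<le> norm (lam *\<^sub>R (?m - z)) + norm ((1 - lam) *\<^sub>R z)"
      by (rule norm_triangle_ineq4)
    also have "\<dots> \<le> lam * (\<eta> * norm z) + (1 - lam) * norm z"
      using assms by (simp add: mult_left_mono)
    finally show "norm (expectation (\<lambda>w. lam *\<^sub>R Y w) - z) \<le> (1 - lam + lam * \<eta>) * norm z"
      by (simp add: algebra_simps)
  qed simp
  also have "lam\<^sup>2 * (\<omega> * (norm z)\<^sup>2) + ((1 - lam + lam * \<eta>) * norm z)\<^sup>2 = diana_r \<eta> \<omega> lam * (norm z)\<^sup>2"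
    unfolding diana_r_def power_mult_distrib by (simp add: distrib_right)
  finally show ?thesis by (simp add: ennreal_leI)
qed

text \<open>The variance of the average is governed by the joint hypothesis \<open>var\<close>,
  whereas the individual biases combine to the factor \<open>\<eta>^2\<close>.\<close>

lemma (in prob_space) nn_integral_mean_error_le:
  fixes Y :: "nat \<Rightarrow> 'a \<Rightarrow> 'b::euclidean_space"
  assumes int: "\<And>i. i < n \<Longrightarrow> integrable M (Y i)"
    and bias: "\<And>i. i < n \<Longrightarrow> norm (expectation (Y i) - z i) \<le> \<eta> * norm (z i)"
    and var: "(\<integral>\<^sup>+w. ennreal ((norm ((1 / real n) *\<^sub>R (\<Sum>i<n. Y i w - expectation (Y i))))\<^sup>2) \<partial>M)
      \<le> ennreal (\<omega> / real n * (\<Sum>i<n. (norm (z i))\<^sup>2))"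
    and "0 \<le> \<omega>" "0 \<le> \<eta>"
  shows "(\<integral>\<^sup>+w. ennreal ((norm ((1 / real n) *\<^sub>R (\<Sum>i<n. Y i w) - (1 / real n) *\<^sub>R (\<Sum>i<n. z i)))\<^sup>2) \<partial>M)
    \<le> ennreal ((\<eta>\<^sup>2 + \<omega>) * (1 / real n * (\<Sum>i<n. (norm (z i))\<^sup>2)))"
proof -
  let ?Y = "\<lambda>w. (1 / real n) *\<^sub>R (\<Sum>i<n. Y i w)" and ?G = "1 / real n * (\<Sum>i<n. (norm (z i))\<^sup>2)"
  have intY: "integrable M ?Y"
    by (intro integrable_scaleR_right Bochner_Integration.integrable_sum) (use int in auto)
  have EY: "expectation ?Y = (1 / real n) *\<^sub>R (\<Sum>i<n. expectation (Y i))"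
  proof -
    have "expectation (\<lambda>w. \<Sum>i<n. Y i w) = (\<Sum>i<n. expectation (Y i))"
      by (rule Bochner_Integration.integral_sum) (use int in auto)
    then show ?thesis by (simp only: integral_scaleR_right)
  qed
  have G: "0 \<le> ?G" by (intro mult_nonneg_nonneg sum_nonneg) auto
  have "(\<integral>\<^sup>+w. ennreal ((norm (?Y w - expectation ?Y))\<^sup>2) \<partial>M) \<le> ennreal (\<omega> * ?G)"
    using var unfolding EY by (simp add: sum_subtractf scaleR_diff_right)
  then have "(\<integral>\<^sup>+w. ennreal ((norm (?Y w - (1 / real n) *\<^sub>R (\<Sum>i<n. z i)))\<^sup>2) \<partial>M)
      \<le> ennreal (\<omega> * ?G + (norm (expectation ?Y - (1 / real n) *\<^sub>R (\<Sum>i<n. z i)))\<^sup>2)"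
    using intY G assms by (intro nn_integral_sq_dist_le mult_nonneg_nonneg[OF \<open>0 \<le> \<omega>\<close> G])
  also have "expectation ?Y - (1 / real n) *\<^sub>R (\<Sum>i<n. z i) = (1 / real n) *\<^sub>R (\<Sum>i<n. expectation (Y i) - z i)"
    unfolding EY by (simp add: sum_subtractf scaleR_diff_right)
  also have "\<omega> * ?G + (norm \<dots>)\<^sup>2 \<le> (\<eta>\<^sup>2 + \<omega>) * ?G"
    using sq_norm_mean_le[of n "\<lambda>i. expectation (Y i) - z i" \<eta> z, OF bias \<open>0 \<le> \<eta>\<close>]
    by (subst distrib_right) linarith
  finally show ?thesis by (simp add: ennreal_leI)
qed

section \<open>The rate and linear convergence of the expected potential\<close>

lemma rate_eq_inverse_min:
  fixes a r :: real
  assumes "0 \<le> a" "0 < r"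
  shows "max (1 / (1 + a)) ((r + 1) / 2) = 1 / min (1 + a) (2 / (1 + r))"
proof -
  have "1 / min x y = max (1 / x) (1 / y)" if "0 < x" "0 < y" for x y :: real
    using that by (auto simp: min_def max_def divide_simps)
  from this[of "1 + a" "2 / (1 + r)"] show ?thesis
    using assms by (simp add: add.commute)
qed

theorem theorem5:
  fixes n :: nat
    and f :: "nat \<Rightarrow> 'a::euclidean_space \<Rightarrow> real"
    and gf :: "nat \<Rightarrow> 'a \<Rightarrow> 'a"
    and Li :: "nat \<Rightarrow> real"
    and L :: real
    and R :: "'a \<Rightarrow> real" and D :: "'a set"
    and xstar :: 'a
    and \<mu> :: real
    and M :: "'o measure" and N :: "'b measure"
    and \<xi> :: "nat \<Rightarrow> 'o \<Rightarrow> 'b"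
    and Cmp :: "nat \<Rightarrow> nat \<Rightarrow> 'b \<Rightarrow> 'a \<Rightarrow> 'a"
    and \<eta> \<omega> \<omega>av \<gamma> lam :: real
    and x0 :: 'a and h0 :: "nat \<Rightarrow> 'a"
  defines "Ltil \<equiv> sqrt ((1 / real n) * (\<Sum>i<n. (Li i)\<^sup>2))"
    and "F \<equiv> (\<lambda>x. (1 / real n) * (\<Sum>i<n. f i x))"
    and "gF \<equiv> (\<lambda>x. (1 / real n) *\<^sub>R (\<Sum>i<n. gf i x))"
    and "r \<equiv> diana_r \<eta> \<omega> lam"
    and "rav \<equiv> \<eta>\<^sup>2 + \<omega>av"
    and "X \<equiv> diana n gf Cmp \<xi> R D \<gamma> lam x0 h0"
    and "\<Psi> \<equiv> (\<lambda>(x, h). (1 / real n) * (\<Sum>i<n. f i x) + R x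
            - (1 / real n) * (\<Sum>i<n. f i xstar) - R xstar
            + \<gamma> / (2 * theta_star (diana_r \<eta> \<omega> lam) (\<eta>\<^sup>2 + \<omega>av)) * ((1 / real n) *
                (\<Sum>i<n. (norm (gf i x - h i))\<^sup>2)))"
  assumes n_pos: "n \<ge> 1"
    \<comment> \<open>each f_i convex and L_i-smooth, with gradient gf i\<close>
    and f_grad: "\<And>i x. i < n \<Longrightarrow> GDERIV (f i) x :> gf i x"
    and f_convex: "\<And>i. i < n \<Longrightarrow> convex_on UNIV (f i)"
    and Li_nonneg: "\<And>i. i < n \<Longrightarrow> Li i \<ge> 0"
    and f_smooth: "\<And>i x y. i < n \<Longrightarrow> norm (gf i x - gf i y) \<le> Li i * norm (x - y)"
    \<comment> \<open>f is L-smooth with L \<le> Ltil\<close>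
    and L_nonneg: "L \<ge> 0"
    and F_smooth: "\<And>x y. norm (gF x - gF y) \<le> L * norm (x - y)"
    and L_le: "L \<le> Ltil"
    \<comment> \<open>R proper closed convex, with effective domain D\<close>
    and R_pcc: "proper_closed_convex R D"
    \<comment> \<open>xstar minimizes f + R\<close>
    and xstar_D: "xstar \<in> D"
    and xstar_min: "\<And>x. x \<in> D \<Longrightarrow> F xstar + R xstar \<le> F x + R x"
    \<comment> \<open>KL condition\<close>
    and mu_pos: "\<mu> > 0"
    and KL: "\<And>x u. u \<in> subdiff R D x \<Longrightarrow>
               (norm (gF x + u))\<^sup>2 \<ge> 2 * \<mu> * (F x + R x - F xstar - R xstar)"
    \<comment> \<open>randomness: independent per-iteration random elements\<close>
    and M_prob: "prob_space M"
    and \<xi>_meas: "\<And>t. \<xi> t \<in> measurable M N"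
    and \<xi>_indep: "prob_space.indep_vars M (\<lambda>_. N) \<xi> UNIV"
    and Cmp_meas: "\<And>t i. (\<lambda>(z, x). Cmp t i z x) \<in> borel_measurable (N \<Otimes>\<^sub>M borel)"
    \<comment> \<open>compressors in the class C(eta, omega)\<close>
    and eta_range: "0 \<le> \<eta>" "\<eta> < 1"
    and omega_nonneg: "\<omega> \<ge> 0"
    and C_int: "\<And>t i x. i < n \<Longrightarrow> integrable M (\<lambda>w. Cmp t i (\<xi> t w) x)"
    and C_bias: "\<And>t i x. i < n \<Longrightarrow>
        norm ((\<integral>w. Cmp t i (\<xi> t w) x \<partial>M) - x) \<le> \<eta> * norm x"
    and C_var: "\<And>t i x. i < n \<Longrightarrow>
        (\<integral>\<^sup>+w. ennreal ((norm (Cmp t i (\<xi> t w) x - (\<integral>v. Cmp t i (\<xi> t v) x \<partial>M)))\<^sup>2) \<partial>M)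
          \<le> ennreal (\<omega> * (norm x)\<^sup>2)"
    and omav_range: "0 \<le> \<omega>av" "\<omega>av \<le> \<omega>"
    and C_avg: "\<And>t xs.
        (\<integral>\<^sup>+w. ennreal ((norm ((1 / real n) *\<^sub>R
             (\<Sum>i<n. Cmp t i (\<xi> t w) (xs i) - (\<integral>v. Cmp t i (\<xi> t v) (xs i) \<partial>M))))\<^sup>2) \<partial>M)
          \<le> ennreal (\<omega>av / real n * (\<Sum>i<n. (norm (xs i))\<^sup>2))"
    and r_pos: "r > 0" and rav_pos: "rav > 0"
    \<comment> \<open>parameters\<close>
    and lam_range: "0 < lam" "lam \<le> 1"
    and r_lt1: "r < 1"
    and gamma_pos: "\<gamma> > 0"
    and gamma_le: "\<gamma> * (2 * L + Ltil * sqrt (rav / r) * (1 / s_star r)) \<le> 1"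
    and x0_D: "x0 \<in> D"
  shows "\<forall>t. (\<integral>\<^sup>+w. ennreal (\<Psi> (X t w)) \<partial>M)
            \<le> ennreal ((max (1 / (1 + \<gamma> * \<mu> / 2)) ((r + 1) / 2)) ^ t * \<Psi> (x0, h0))"
proof -
  interpret prob_space M by (rule M_prob)
  have F_grad: "GDERIV F x :> gF x" for x
  proof -
    have "((\<lambda>x. (1 / real n) * (\<Sum>i<n. f i x)) has_derivative
        (\<lambda>h. (1 / real n) * (\<Sum>i<n. inner h (gf i x)))) (at x)"
      using f_grad by (intro has_derivative_mult_right has_derivative_sum) (auto simp: gderiv_def)
    then show ?thesis
      by (simp add: F_def gF_def gderiv_def inner_sum_right sum_distrib_left)
  qed
  have F_convex: "convex_on UNIV F"
  proof -
    have "convex_on UNIV (\<lambda>x. \<Sum>i\<in>I. f i x)" if "I \<subseteq> {..<n}" for I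
      using finite_subset[OF that] that
      by (induction rule: finite_induct) (auto intro!: convex_on_add f_convex simp: convex_on_const)
    then show ?thesis unfolding F_def by (intro convex_on_cmul) auto
  qed
  interpret smooth_composite F gF L R D xstar
    by unfold_locales (fact F_grad F_convex F_smooth R_pcc xstar_D xstar_min)+

  \<comment> \<open>Constants and the step size condition\<close>
  define s where "s = s_star r"
  define \<theta> where "\<theta> = theta_star r rav"
  have s: "0 < s" unfolding s_def using r_pos r_lt1 by (rule s_star_pos)
  have s_sq: "(1 + s)\<^sup>2 * r = (1 + r) / 2" unfolding s_def using r_pos by (rule s_star_sq)
  have \<theta>_eq: "\<theta> = s * (1 + s) * r / rav" by (simp add: \<theta>_def theta_star_def s_def)
  have \<theta>: "0 < \<theta>" using s r_pos rav_pos by (simp add: \<theta>_eq)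
  define \<kappa> where "\<kappa> = \<gamma> / (2 * \<theta>)"
  have \<kappa>: "0 < \<kappa>" using \<theta> gamma_pos by (simp add: \<kappa>_def)
  \<comment> \<open>The formula for \<open>\<theta>\<close> is chosen for this identity: the
    gradient error then costs exactly \<open>s\<close> times the shift error term
    \<open>\<kappa> * (1 + s) * r\<close>.\<close>
  have \<kappa>_rav: "\<gamma> / 2 * rav = \<kappa> * (s * (1 + s) * r)"
    using s r_pos rav_pos by (simp add: \<kappa>_def \<theta>_eq)
  have Ltil: "0 \<le> Ltil" unfolding Ltil_def by (simp add: sum_nonneg)
  have Ltil_sq: "Ltil\<^sup>2 = 1 / real n * (\<Sum>i<n. (Li i)\<^sup>2)" unfolding Ltil_def by (simp add: sum_nonneg)

  \<comment> \<open>Gradient drift will add \<open>\<kappa> * (1 + 1 / s) * Ltil^2\<close> times the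
    squared step length; \<open>B\<close> is this coefficient in units of
    \<open>1 / (2 * \<gamma>)\<close>.\<close>
  define B where "B = 2 * \<gamma> * \<kappa> * ((1 + 1 / s) * Ltil\<^sup>2)"
  have step_size: "\<gamma> * L + B \<le> 1"
  proof -
    \<comment> \<open>\<open>b\<close> is the square root of \<open>B\<close> and also the second
      term of the step size condition, so
      \<open>b^2 \<le> b \<le> 1 - 2 * (\<gamma> * L)\<close>.\<close>
    define b where "b = \<gamma> * Ltil * sqrt (rav / r) / s"
    have b: "0 \<le> b" using gamma_pos Ltil rav_pos r_pos s by (simp add: b_def)
    have "2 * (\<gamma> * L) + b \<le> 1" using gamma_le by (simp add: b_def s_def algebra_simps)
    moreover have "0 \<le> \<gamma> * L" using gamma_pos L_nonneg by simp
    moreover have "b\<^sup>2 \<le> b" if "b \<le> 1"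
      using b that by (simp add: power2_eq_square mult_left_le)
    moreover have "B = b\<^sup>2"
    proof -
      define p where "p = 1 + s"
      have p: "p > 0" "1 + 1 / s = p / s" using s by (simp_all add: p_def field_simps)
      have "b\<^sup>2 = \<gamma>\<^sup>2 * Ltil\<^sup>2 * (rav / r) / s\<^sup>2"
        using rav_pos r_pos by (simp add: b_def power_mult_distrib power_divide)
      then show ?thesis
        unfolding B_def \<kappa>_def \<theta>_eq p(2) p_def[symmetric]
        using s p(1) rav_pos r_pos by (simp add: power2_eq_square ac_simps)
    qed
    ultimately show ?thesis by linarith
  qed

  define K where "K = min (1 + \<gamma> * \<mu> / 2) (2 / (1 + r))"
  define \<rho> where "\<rho> = max (1 / (1 + \<gamma> * \<mu> / 2)) ((r + 1) / 2)"
  have \<rho>_K: "\<rho> = 1 / K"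
    unfolding \<rho>_def K_def using gamma_pos mu_pos r_pos by (intro rate_eq_inverse_min) auto
  have K: "1 \<le> K" "K \<le> 2" "K \<le> 1 + \<gamma> * \<mu> / 2"
  proof -
    have "1 \<le> 2 / (1 + r)" "2 / (1 + r) \<le> 2" using r_pos r_lt1 by (auto simp: field_simps)
    moreover have "0 \<le> \<gamma> * \<mu> / 2" using gamma_pos mu_pos by simp
    ultimately show "1 \<le> K" "K \<le> 2" "K \<le> 1 + \<gamma> * \<mu> / 2" by (auto simp: K_def)
  qed
  have \<rho>: "0 \<le> \<rho>" "(1 + r) / 2 \<le> \<rho>"
  proof -
    show "(1 + r) / 2 \<le> \<rho>" unfolding \<rho>_def by (subst add.commute) (rule max.cobounded2)
    then show "0 \<le> \<rho>" by (rule order_trans[rotated]) (use r_pos in simp)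
  qed

  \<comment> \<open>The potential and its pathwise one-step bound\<close>
  define G where "G x h = 1 / real n * (\<Sum>i<n. (norm (gf i x - h i))\<^sup>2)" for x h
  have G: "0 \<le> G x h" for x h unfolding G_def by (intro mult_nonneg_nonneg sum_nonneg) auto
  have \<Psi>_eq: "\<Psi> (x, h) = gap x + \<kappa> * G x h" for x h
    by (simp add: \<Psi>_def \<kappa>_def \<theta>_def G_def F_def r_def rav_def)

  \<comment> \<open>With compressor outputs \<open>c\<close>, this is the error of the gradient
    estimate: mean shift plus mean output equals \<open>gF x + E x h c\<close>.\<close>
  define E where "E x h c = (1 / real n) *\<^sub>R (\<Sum>i<n. c i) - (1 / real n) *\<^sub>R (\<Sum>i<n. gf i x - h i)"
    for x :: 'a and h c :: "nat \<Rightarrow> 'a"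
  have step: "\<Psi> (prox \<gamma> R D (x - \<gamma> *\<^sub>R ((1 / real n) *\<^sub>R (\<Sum>i<n. h i) + (1 / real n) *\<^sub>R (\<Sum>i<n. c i))),
      \<lambda>i. h i + lam *\<^sub>R c i)
    \<le> gap x / K + \<gamma> / 2 * (norm (E x h c))\<^sup>2
      + \<kappa> * (1 + s) / n * (\<Sum>i<n. (norm (lam *\<^sub>R c i - (gf i x - h i)))\<^sup>2)"
    if x: "x \<in> D" for x h c
  proof -
    define x' where "x' = prox \<gamma> R D (x - \<gamma> *\<^sub>R ((1 / real n) *\<^sub>R (\<Sum>i<n. h i) + (1 / real n) *\<^sub>R (\<Sum>i<n. c i)))"
    have "(1 / real n) *\<^sub>R (\<Sum>i<n. h i) + (1 / real n) *\<^sub>R (\<Sum>i<n. c i) = gF x + E x h c"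
      by (simp add: E_def gF_def sum_subtractf scaleR_diff_right)
    then have "gap x' + B / (2 * \<gamma>) * (norm (x' - x))\<^sup>2 \<le> gap x / K + \<gamma> / 2 * (norm (E x h c))\<^sup>2"
      unfolding x'_def by (intro prox_gradient_step[OF KL gamma_pos K x step_size]) auto
    moreover have "G x' (\<lambda>i. h i + lam *\<^sub>R c i) \<le>
        (1 + s) / n * (\<Sum>i<n. (norm (lam *\<^sub>R c i - (gf i x - h i)))\<^sup>2) + (1 + 1 / s) * Ltil\<^sup>2 * (norm (x' - x))\<^sup>2"
    proof -
      have "(norm (gf i x' - (h i + lam *\<^sub>R c i)))\<^sup>2 \<le> (1 + s) * (norm (lam *\<^sub>R c i - (gf i x - h i)))\<^sup>2
          + (1 + 1 / s) * ((Li i)\<^sup>2 * (norm (x' - x))\<^sup>2)" if i: "i < n" for i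
      proof -
        \<comment> \<open>The new residual is split into the compression error at \<open>x\<close>
          and the drift of the gradient from \<open>x\<close> to \<open>x'\<close>; Young's
          inequality with parameter \<open>s\<close> separates them.\<close>
        have "gf i x' - (h i + lam *\<^sub>R c i) = - (lam *\<^sub>R c i - (gf i x - h i)) + (gf i x' - gf i x)"
          by simp
        then have "(norm (gf i x' - (h i + lam *\<^sub>R c i)))\<^sup>2
            \<le> (1 + s) * (norm (lam *\<^sub>R c i - (gf i x - h i)))\<^sup>2 + (1 + 1 / s) * (norm (gf i x' - gf i x))\<^sup>2"
          using norm_add_sq_le[OF s] by (metis norm_minus_cancel)
        also have "(norm (gf i x' - gf i x))\<^sup>2 \<le> (Li i * norm (x' - x))\<^sup>2"
          using f_smooth[OF i] by (intro power_mono) auto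
        finally show ?thesis using s by (simp add: power_mult_distrib mult_left_mono)
      qed
      then have "(\<Sum>i<n. (norm (gf i x' - (h i + lam *\<^sub>R c i)))\<^sup>2) \<le>
          (\<Sum>i<n. (1 + s) * (norm (lam *\<^sub>R c i - (gf i x - h i)))\<^sup>2 + (1 + 1 / s) * ((Li i)\<^sup>2 * (norm (x' - x))\<^sup>2))"
        by (intro sum_mono) auto
      also have "\<dots> = (1 + s) * (\<Sum>i<n. (norm (lam *\<^sub>R c i - (gf i x - h i)))\<^sup>2)
          + (1 + 1 / s) * ((\<Sum>i<n. (Li i)\<^sup>2) * (norm (x' - x))\<^sup>2)"
        by (simp only: sum.distrib sum_distrib_left sum_distrib_right)
      finally have "G x' (\<lambda>i. h i + lam *\<^sub>R c i) \<le> 1 / real n *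
          ((1 + s) * (\<Sum>i<n. (norm (lam *\<^sub>R c i - (gf i x - h i)))\<^sup>2)
          + (1 + 1 / s) * ((\<Sum>i<n. (Li i)\<^sup>2) * (norm (x' - x))\<^sup>2))"
        unfolding G_def by (intro mult_left_mono) auto
      then show ?thesis by (simp add: Ltil_sq ring_distribs add_divide_distrib mult.commute)
    qed
    then have "\<kappa> * G x' (\<lambda>i. h i + lam *\<^sub>R c i) \<le> \<kappa> * ((1 + s) / n *
        (\<Sum>i<n. (norm (lam *\<^sub>R c i - (gf i x - h i)))\<^sup>2) + (1 + 1 / s) * Ltil\<^sup>2 * (norm (x' - x))\<^sup>2)"
      using \<kappa> by (intro mult_left_mono) auto
    \<comment> \<open>The drift term is thereby absorbed by the squared step length on the left of
      the inexact step inequality.\<close>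
    moreover have "B / (2 * \<gamma>) = \<kappa> * ((1 + 1 / s) * Ltil\<^sup>2)" using gamma_pos by (simp add: B_def)
    moreover have "\<kappa> * ((1 + s) / n * a + (1 + 1 / s) * Ltil\<^sup>2 * b)
        = \<kappa> * (1 + s) / n * a + \<kappa> * ((1 + 1 / s) * Ltil\<^sup>2) * b" for a b
      by (simp add: distrib_left[of \<kappa> "_ * a"] distrib_left[of \<kappa> "_ / _"] mult.assoc)
    ultimately show ?thesis
      unfolding \<Psi>_eq x'_def[symmetric] by simp
  qed

  \<comment> \<open>The one-step bound as a measurable function of state and fresh noise\<close>
  \<comment> \<open>A total Borel version of \<open>R\<close>; it agrees with \<open>R\<close> at
    all iterates because they stay in \<open>D\<close>.\<close>
  define Rm where "Rm x = (if x \<in> D then R x else 0)" for x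
  define C where "C t x h z i = Cmp t i z (gf i x - h i)" for t x h z i
  \<comment> \<open>The bound of \<open>step\<close>, split into extended nonnegative summands so
    that the integral is additive without integrability conditions.\<close>
  define U where "U t = (\<lambda>((x, h), z). ennreal ((F x + Rm x - F xstar - R xstar) / K)
      + (ennreal (\<gamma> / 2) * ennreal ((norm (E x h (C t x h z)))\<^sup>2)
      + ennreal (\<kappa> * (1 + s) / n) * (\<Sum>i<n. ennreal ((norm (lam *\<^sub>R C t x h z i - (gf i x - h i)))\<^sup>2))))" for t
  \<comment> \<open>\<open>gf i\<close> is known to be measurable only for \<open>i < n\<close>, hence the restriction of the shifts.\<close>
  define S where "S t w = (case X t w of (x, h) \<Rightarrow> (x, restrict h {..<n}))" for t w
  let ?S = "borel \<Otimes>\<^sub>M PiM {..<n} (\<lambda>_. borel) :: ('a \<times> (nat \<Rightarrow> 'a)) measure"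

  have prox_meas: "prox \<gamma> R D \<in> borel_measurable borel"
    using prox_nonexpansive'[OF gamma_pos] by (intro lipschitz_imp_borel_measurable[of _ 1]) auto
  have gf_meas: "gf i \<in> borel_measurable borel" if "i < n" for i
    using f_smooth Li_nonneg that by (intro lipschitz_imp_borel_measurable[of _ "Li i"]) auto
  have F_meas: "F \<in> borel_measurable borel"
    by (intro borel_measurable_continuous_onI continuous_at_imp_continuous_on ballI isCont_F)
  have Rm_meas: "Rm \<in> borel_measurable borel"
    using closed_epigraph_measurable(2)[OF closed_epi] by (simp add: Rm_def[abs_def])
  have z_meas: "(\<lambda>q. gf i (fst q) - snd q i) \<in> borel_measurable ?S" if "i < n" for i
    using that
    by (intro borel_measurable_diff measurable_compose[OF measurable_fst gf_meas]
        measurable_compose[OF measurable_snd] measurable_component_singleton) auto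
  have C_meas: "(\<lambda>q. C t (fst (fst q)) (snd (fst q)) (snd q) i) \<in> borel_measurable (?S \<Otimes>\<^sub>M N)"
    if "i < n" for t i
    using measurable_compose[OF measurable_Pair[OF measurable_snd
        measurable_compose[OF measurable_fst z_meas[OF that]]] Cmp_meas[of t i]]
    by (simp add: C_def)
  have U_meas: "U t \<in> borel_measurable (?S \<Otimes>\<^sub>M N)" for t
  proof -
    have gapm: "(\<lambda>q. (F (fst (fst q)) + Rm (fst (fst q)) - F xstar - R xstar) / K) \<in> borel_measurable (?S \<Otimes>\<^sub>M N)"
      by (intro borel_measurable_divide borel_measurable_diff borel_measurable_add borel_measurable_const
          measurable_compose[OF measurable_compose[OF measurable_fst measurable_fst] F_meas]
          measurable_compose[OF measurable_compose[OF measurable_fst measurable_fst] Rm_meas])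
    have z: "(\<lambda>q. gf i (fst (fst q)) - snd (fst q) i) \<in> borel_measurable (?S \<Otimes>\<^sub>M N)" if "i < n" for i
      by (rule measurable_compose[OF measurable_fst z_meas[OF that]])
    have "(\<lambda>q. E (fst (fst q)) (snd (fst q)) (C t (fst (fst q)) (snd (fst q)) (snd q)))
        \<in> borel_measurable (?S \<Otimes>\<^sub>M N)"
      unfolding E_def
      by (intro borel_measurable_diff borel_measurable_scaleR borel_measurable_const
          borel_measurable_sum C_meas z) auto
    moreover have "(\<lambda>q. lam *\<^sub>R C t (fst (fst q)) (snd (fst q)) (snd q) i - (gf i (fst (fst q)) - snd (fst q) i))
        \<in> borel_measurable (?S \<Otimes>\<^sub>M N)" if "i < n" for i
      by (intro borel_measurable_diff[OF _ z] borel_measurable_scaleR borel_measurable_const C_meas that)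
    ultimately show ?thesis
      unfolding U_def case_prod_beta using gapm
      by (intro borel_measurable_add borel_measurable_times_ennreal borel_measurable_const
          borel_measurable_sum measurable_compose[OF _ measurable_ennreal] borel_measurable_power
          borel_measurable_norm) auto
  qed

  have in_D: "fst (X t w) \<in> D" for t w
    by (cases t) (simp_all add: X_def x0_D diana_fst_Suc prox_in_D[OF gamma_pos] Let_def case_prod_beta del: diana.simps(2))

  have pointwise: "ennreal (\<Psi> (X (Suc t) w)) \<le> U t (S t w, \<xi> t w)" for t w
  proof -
    obtain x h where xh: "X t w = (x, h)" by fastforce
    have x: "x \<in> D" using in_D[of t w] xh by simp
    let ?h = "restrict h {..<n}"
    let ?c = "C t x h (\<xi> t w)"
    have c: "C t x ?h (\<xi> t w) i = ?c i" if "i < n" for i using that by (simp add: C_def)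
    have Eeq: "E x ?h (C t x ?h (\<xi> t w)) = E x h ?c"
      unfolding E_def using c by simp
    have "X (Suc t) w = (prox \<gamma> R D (x - \<gamma> *\<^sub>R ((1 / real n) *\<^sub>R (\<Sum>i<n. h i) + (1 / real n) *\<^sub>R (\<Sum>i<n. ?c i))),
        \<lambda>i. h i + lam *\<^sub>R ?c i)"
      using xh by (simp add: X_def Let_def C_def)
    then have "\<Psi> (X (Suc t) w) \<le> gap x / K + \<gamma> / 2 * (norm (E x h ?c))\<^sup>2
        + \<kappa> * (1 + s) / n * (\<Sum>i<n. (norm (lam *\<^sub>R ?c i - (gf i x - h i)))\<^sup>2)"
      using step[OF x, of h ?c] by simp
    then have "ennreal (\<Psi> (X (Suc t) w)) \<le> ennreal (gap x / K + (\<gamma> / 2 * (norm (E x h ?c))\<^sup>2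
        + \<kappa> * (1 + s) / n * (\<Sum>i<n. (norm (lam *\<^sub>R ?c i - (gf i x - h i)))\<^sup>2)))"
      by (intro ennreal_leI) simp
    also have "\<dots> = ennreal (gap x / K) + (ennreal (\<gamma> / 2) * ennreal ((norm (E x h ?c))\<^sup>2)
        + ennreal (\<kappa> * (1 + s) / n) * (\<Sum>i<n. ennreal ((norm (lam *\<^sub>R ?c i - (gf i x - h i)))\<^sup>2)))"
      using gap_nonneg[OF x] K gamma_pos \<kappa> s
      by (simp add: ennreal_plus ennreal_mult sum_ennreal sum_nonneg del: times_divide_eq_left)
    also have "\<dots> = U t (S t w, \<xi> t w)"
      using c x by (simp add: U_def S_def xh Eeq Rm_def)
    finally show ?thesis .
  qed

  \<comment> \<open>Integration over the fresh noise with the state frozen\<close>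
  have conditional: "(\<integral>\<^sup>+v. U t ((x, h), \<xi> t v) \<partial>M) \<le> ennreal (\<rho> * \<Psi> (x, h))" if x: "x \<in> D" for t x h
  proof -
    define z where "z i = gf i x - h i" for i
    have C_eq: "C t x h (\<xi> t v) i = Cmp t i (\<xi> t v) (z i)" for v i by (simp add: C_def z_def)
    have [measurable]: "(\<lambda>v. C t x h (\<xi> t v) i) \<in> borel_measurable M" if "i < n" for i
      using C_int[OF that] by (auto simp: C_eq)
    have [measurable]: "(\<lambda>v. E x h (C t x h (\<xi> t v))) \<in> borel_measurable M"
      unfolding E_def by measurable
    have mean: "(\<integral>\<^sup>+v. ennreal ((norm (E x h (C t x h (\<xi> t v))))\<^sup>2) \<partial>M) \<le> ennreal (rav * G x h)"
      unfolding E_def rav_def G_def C_eq z_def[symmetric]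
      using C_int C_bias C_avg[of t z] omav_range eta_range by (intro nn_integral_mean_error_le) auto
    have shift: "(\<integral>\<^sup>+v. ennreal ((norm (lam *\<^sub>R C t x h (\<xi> t v) i - (gf i x - h i)))\<^sup>2) \<partial>M)
        \<le> ennreal (r * (norm (gf i x - h i))\<^sup>2)" if i: "i < n" for i
      unfolding r_def C_eq z_def[symmetric]
      using C_int[OF i] C_bias[OF i] C_var[OF i] omega_nonneg lam_range
      by (intro nn_integral_shift_error_le) auto
    have "(\<integral>\<^sup>+v. (\<Sum>i<n. ennreal ((norm (lam *\<^sub>R C t x h (\<xi> t v) i - (gf i x - h i)))\<^sup>2)) \<partial>M)
        = (\<Sum>i<n. \<integral>\<^sup>+v. ennreal ((norm (lam *\<^sub>R C t x h (\<xi> t v) i - (gf i x - h i)))\<^sup>2) \<partial>M)"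
      by (intro nn_integral_sum) measurable
    then have "(\<integral>\<^sup>+v. U t ((x, h), \<xi> t v) \<partial>M) = ennreal (gap x / K)
      + (ennreal (\<gamma> / 2) * (\<integral>\<^sup>+v. ennreal ((norm (E x h (C t x h (\<xi> t v))))\<^sup>2) \<partial>M)
      + ennreal (\<kappa> * (1 + s) / n) *
        (\<Sum>i<n. \<integral>\<^sup>+v. ennreal ((norm (lam *\<^sub>R C t x h (\<xi> t v) i - (gf i x - h i)))\<^sup>2) \<partial>M))"
      using x unfolding U_def
      by (simp add: nn_integral_add nn_integral_cmult Rm_def emeasure_space_1 del: sum_ennreal)
    also have "\<dots> \<le> ennreal (gap x / K) + (ennreal (\<gamma> / 2) * ennreal (rav * G x h)
        + ennreal (\<kappa> * (1 + s) / n) * (\<Sum>i<n. ennreal (r * (norm (gf i x - h i))\<^sup>2)))"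
      by (intro add_left_mono add_mono mult_left_mono mean sum_mono shift) auto
    also have "\<dots> = ennreal (gap x / K + (\<gamma> / 2 * (rav * G x h)
        + \<kappa> * (1 + s) / n * (\<Sum>i<n. r * (norm (gf i x - h i))\<^sup>2)))"
      using gap_nonneg[OF x] K gamma_pos \<kappa> s rav_pos r_pos G[of x h]
      by (subst sum_ennreal) (simp_all add: ennreal_plus ennreal_mult sum_nonneg del: times_divide_eq_left)
    also have "\<dots> \<le> ennreal (\<rho> * \<Psi> (x, h))"
    proof (rule ennreal_leI)
      have "\<gamma> / 2 * (rav * G x h) = \<kappa> * (s * (1 + s) * r) * G x h"
        by (simp only: mult.assoc[symmetric] \<kappa>_rav)
      moreover have "\<kappa> * (1 + s) / n * (\<Sum>i<n. r * (norm (gf i x - h i))\<^sup>2) = \<kappa> * ((1 + s) * r) * G x h"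
        by (simp add: G_def sum_distrib_left[symmetric])
      \<comment> \<open>Gradient error and shift error add up through
        \<open>s * (1 + s) + (1 + s) = (1 + s)^2\<close>.\<close>
      moreover have "\<kappa> * (s * (1 + s) * r) * G x h + \<kappa> * ((1 + s) * r) * G x h = (1 + s)\<^sup>2 * r * (\<kappa> * G x h)"
        by (simp add: power2_eq_square algebra_simps)
      moreover have "(1 + s)\<^sup>2 * r * (\<kappa> * G x h) \<le> \<rho> * (\<kappa> * G x h)"
        unfolding s_sq using \<rho>(2) \<kappa> G[of x h] by (intro mult_right_mono) auto
      moreover have "\<rho> * \<Psi> (x, h) = gap x / K + \<rho> * (\<kappa> * G x h)"
        by (simp only: \<Psi>_eq distrib_left) (simp add: \<rho>_K)
      ultimately show "gap x / K + (\<gamma> / 2 * (rav * G x h)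
          + \<kappa> * (1 + s) / n * (\<Sum>i<n. r * (norm (gf i x - h i))\<^sup>2)) \<le> \<rho> * \<Psi> (x, h)"
        by linarith
    qed
    finally show ?thesis .
  qed

  \<comment> \<open>From frozen states to the iterates, and induction over time\<close>
  have S_meas: "S t \<in> measurable M ?S"
    and iterate: "(\<integral>\<^sup>+w. U t (S t w, \<xi> t w) \<partial>M) = (\<integral>\<^sup>+w. (\<integral>\<^sup>+v. U t (S t w, \<xi> t v) \<partial>M) \<partial>M)" for t
    unfolding S_def[abs_def] X_def
    by (rule nn_integral_diana_iterate; rule prox_meas gf_meas Cmp_meas \<xi>_indep U_meas; assumption?)+
  have \<Psi>_S: "\<Psi> (S t w) = \<Psi> (X t w)" for t w
    by (simp add: S_def \<Psi>_eq G_def split: prod.split)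
  \<comment> \<open>Measurability is what allows the factor \<open>\<rho>\<close> to leave the
    integral in the induction step.\<close>
  have \<Psi>_meas: "(\<lambda>w. \<Psi> (X t w)) \<in> borel_measurable M" for t
  proof -
    have "(\<lambda>q. F (fst q) + Rm (fst q) - F xstar - R xstar
        + \<kappa> * (1 / real n * (\<Sum>i<n. (norm (gf i (fst q) - snd q i))\<^sup>2))) \<in> borel_measurable ?S"
      by (intro borel_measurable_diff borel_measurable_add borel_measurable_const borel_measurable_times
          borel_measurable_sum borel_measurable_power
          measurable_compose[OF measurable_fst F_meas] measurable_compose[OF measurable_fst Rm_meas])
        (use measurable_compose[OF z_meas borel_measurable_norm] in auto)
    from measurable_compose[OF S_meas[of t] this]
    have "(\<lambda>w. F (fst (S t w)) + Rm (fst (S t w)) - F xstar - R xstar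
        + \<kappa> * (1 / real n * (\<Sum>i<n. (norm (gf i (fst (S t w)) - snd (S t w) i))\<^sup>2))) \<in> borel_measurable M" .
    moreover have "\<Psi> (X t w) = F (fst (S t w)) + Rm (fst (S t w)) - F xstar - R xstar
        + \<kappa> * (1 / real n * (\<Sum>i<n. (norm (gf i (fst (S t w)) - snd (S t w) i))\<^sup>2))" for w
      using in_D[of t w] by (cases "X t w") (simp add: S_def \<Psi>_eq G_def Rm_def)
    ultimately show ?thesis by presburger
  qed
  have "(\<integral>\<^sup>+w. ennreal (\<Psi> (X t w)) \<partial>M) \<le> ennreal (\<rho> ^ t * \<Psi> (x0, h0))" for t
  proof (induction t)
    case 0
    then show ?case by (simp add: X_def emeasure_space_1)
  next
    case (Suc t)
    have "(\<integral>\<^sup>+w. ennreal (\<Psi> (X (Suc t) w)) \<partial>M) \<le> (\<integral>\<^sup>+w. U t (S t w, \<xi> t w) \<partial>M)"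
      by (intro nn_integral_mono pointwise)
    also have "\<dots> = (\<integral>\<^sup>+w. (\<integral>\<^sup>+v. U t (S t w, \<xi> t v) \<partial>M) \<partial>M)"
      by (rule iterate)
    also have "\<dots> \<le> (\<integral>\<^sup>+w. ennreal (\<rho> * \<Psi> (S t w)) \<partial>M)"
      using in_D[of t] by (intro nn_integral_mono) (auto simp: S_def case_prod_beta intro!: conditional)
    also have "\<dots> = ennreal \<rho> * (\<integral>\<^sup>+w. ennreal (\<Psi> (X t w)) \<partial>M)"
      using \<rho>(1) \<Psi>_meas[of t] by (simp add: \<Psi>_S ennreal_mult' nn_integral_cmult)
    also have "\<dots> \<le> ennreal \<rho> * ennreal (\<rho> ^ t * \<Psi> (x0, h0))"
      by (intro mult_left_mono Suc.IH) simp
    also have "\<dots> = ennreal (\<rho> ^ Suc t * \<Psi> (x0, h0))"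
      using \<rho>(1) by (simp add: ennreal_mult'[symmetric] mult.assoc)
    finally show ?case .
  qed
  then show ?thesis unfolding \<rho>_def by blast
qed

end
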